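(* Suppose that $E\subset\mathbb{R}$ is a weakly homogeneous set. If $\mu\in\mathcal{R}(E)$, then $\mu_s(E)=0$.
   Context: A Borel set $E\subset\mathbb{R}$ is called weakly homogeneous if $\limsup_{h\to0+}\frac1{2h}|E\cap(x-h,x+h)|>0$ for all $x\in E$, where $|\cdot|$ is Lebesgue measure. A Herglotz function is a holomorphic mapping $F$ of $\mathbb{C}^+=\{z\in\mathbb{C}:\operatorname{Im} z>0\}$ to itself; for such $F$ the limit $F(t)=\lim_{y\to0+}F(t+iy)$ exists for Lebesgue almost every $t\in\mathbb{R}$. $\mathcal{N}(E)$ is the set of Herglotz functions that are reflectionless on $E$, i.e. $\operatorname{Re}F(t)=0$ for almost every $t\in E$. Every Herglotz function has a unique representation $$F(z)=F_\mu(z)=a+bz+\int_{-\infty}^\infty\left(\frac1{t-z}-\frac{t}{t^2+1}\right)d\mu(t),$$ with $a\in\mathbb{R}$, $b\ge0$ and a positive Borel measure $\mu$ on $\mathbb{R}$ with $\int_{\mathbb{R}}\frac{d\mu(t)}{t^2+1}<\infty$. $\mathcal{R}(E)$ is the set of all such measures $\mu$ for which $F_\mu\in\mathcal{N}(E)$ for some choice of $a\in\mathbb{R}$, $b\ge0$. $\mu_s$ denotes the singular part of $\mu$ with respect to Lebesgue measure. *)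

theory Defs
  imports "HOL-Complex_Analysis.Complex_Analysis"
begin

definition weakly_homogeneous :: "real set \<Rightarrow> bool" where
  "weakly_homogeneous E \<longleftrightarrow>
     E \<in> sets borel \<and>
     (\<forall>x\<in>E. Limsup (at_right 0)
        (\<lambda>h. ereal (measure lborel (E \<inter> {x - h<..<x + h}) / (2 * h))) > 0)"

definition upper_half_plane :: "complex set" where
  "upper_half_plane = {z. Im z > 0}"

text \<open>Only the values on the upper half plane matter; a Herglotz function is represented by
  any total function with the right restriction.\<close>

definition herglotz :: "(complex \<Rightarrow> complex) \<Rightarrow> bool" where
  "herglotz F \<longleftrightarrow>
     F holomorphic_on upper_half_plane \<and> F ` upper_half_plane \<subseteq> upper_half_plane"

text \<open>The boundary value \<open>F(t)\<close> is the vertical limit at \<open>t\<close>, not the value of the total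
  function at the real point \<open>t\<close>.\<close>

definition reflectionless_on :: "(complex \<Rightarrow> complex) \<Rightarrow> real set \<Rightarrow> bool" where
  "reflectionless_on F E \<longleftrightarrow>
     (AE t in lborel. t \<in> E \<longrightarrow>
        (\<exists>l. ((\<lambda>y. F (Complex t y)) \<longlongrightarrow> l) (at_right 0) \<and> Re l = 0))"

definition reflectionless_herglotz :: "real set \<Rightarrow> (complex \<Rightarrow> complex) set" where
  "reflectionless_herglotz E = {F. herglotz F \<and> reflectionless_on F E}"

definition herglotz_measure :: "real measure \<Rightarrow> bool" where
  "herglotz_measure \<mu> \<longleftrightarrow>
     sets \<mu> = sets borel \<and> (\<integral>\<^sup>+ t. ennreal (1 / (t\<^sup>2 + 1)) \<partial>\<mu>) < \<infinity>"

definition herglotz_rep :: "real \<Rightarrow> real \<Rightarrow> real measure \<Rightarrow> complex \<Rightarrow> complex" where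
  "herglotz_rep a b \<mu> z =
     of_real a + of_real b * z
     + (LINT t|\<mu>. 1 / (of_real t - z) - of_real (t / (t\<^sup>2 + 1)))"

definition reflectionless_measures :: "real set \<Rightarrow> real measure set" where
  "reflectionless_measures E =
     {\<mu>. herglotz_measure \<mu> \<and> (\<exists>a b. b \<ge> 0 \<and> herglotz_rep a b \<mu> \<in> reflectionless_herglotz E)}"

definition lebesgue_decomposition ::
    "real measure \<Rightarrow> real measure \<Rightarrow> real measure \<Rightarrow> bool" where
  "lebesgue_decomposition \<mu> \<alpha> \<sigma> \<longleftrightarrow>
     sets \<alpha> = sets borel \<and> sets \<sigma> = sets borel \<and>
     (\<forall>A\<in>sets borel. emeasure \<mu> A = emeasure \<alpha> A + emeasure \<sigma> A) \<and>
     absolutely_continuous lborel \<alpha> \<and>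
     (\<exists>N\<in>null_sets lborel. emeasure \<sigma> (- N) = 0)"

text \<open>Uniqueness holds for every Borel measure and existence for the sigma-finite ones (see
  below), so the description is proper on all Herglotz measures.\<close>

definition singular_part :: "real measure \<Rightarrow> real measure" where
  "singular_part \<mu> = (THE \<sigma>. \<exists>\<alpha>. lebesgue_decomposition \<mu> \<alpha> \<sigma>)"

lemma lebesgue_decomposition_singular_on:
  assumes d: "lebesgue_decomposition \<mu> \<alpha> \<sigma>"
    and N: "N \<in> null_sets lborel" "emeasure \<sigma> (- N) = 0"
    and M: "M \<in> null_sets lborel" "N \<subseteq> M" and A: "A \<in> sets borel"
  shows "emeasure \<sigma> A = emeasure \<mu> (A \<inter> M)"
proof -
  have s: "sets \<sigma> = sets borel" "sets \<alpha> = sets borel"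
    using d by (auto simp: lebesgue_decomposition_def)
  have b: "N \<in> sets borel" "M \<in> sets borel" using N M by (auto simp: null_sets_def)
  have "emeasure \<sigma> (A - M) \<le> emeasure \<sigma> (- N)"
    using M b s by (intro emeasure_mono) auto
  then have 0: "emeasure \<sigma> (A - M) = 0" using N by simp
  have "emeasure \<sigma> A = emeasure \<sigma> (A \<inter> M) + emeasure \<sigma> (A - M)"
    using A b s by (subst plus_emeasure) (auto simp: Int_Diff_Un)
  moreover have "A \<inter> M \<in> null_sets lborel"
    using M A by (intro null_set_Int1) auto
  then have "emeasure \<alpha> (A \<inter> M) = 0"
    using d by (auto simp: lebesgue_decomposition_def absolutely_continuous_def null_sets_def)
  moreover have "emeasure \<mu> (A \<inter> M) = emeasure \<alpha> (A \<inter> M) + emeasure \<sigma> (A \<inter> M)"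
    using d A b by (auto simp: lebesgue_decomposition_def)
  ultimately show ?thesis using 0 by simp
qed

lemma lebesgue_decomposition_unique:
  assumes d: "lebesgue_decomposition \<mu> \<alpha> \<sigma>" and d': "lebesgue_decomposition \<mu> \<alpha>' \<sigma>'"
  shows "\<sigma> = \<sigma>'"
proof -
  obtain N where N: "N \<in> null_sets lborel" "emeasure \<sigma> (- N) = 0"
    using d by (auto simp: lebesgue_decomposition_def)
  obtain N' where N': "N' \<in> null_sets lborel" "emeasure \<sigma>' (- N') = 0"
    using d' by (auto simp: lebesgue_decomposition_def)
  have M: "N \<union> N' \<in> null_sets lborel" using N N' by auto
  show ?thesis
  proof (rule measure_eqI)
    show "sets \<sigma> = sets \<sigma>'" using d d' by (auto simp: lebesgue_decomposition_def)
    fix A assume "A \<in> sets \<sigma>"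
    then have A: "A \<in> sets borel" using d by (auto simp: lebesgue_decomposition_def)
    show "emeasure \<sigma> A = emeasure \<sigma>' A"
      using lebesgue_decomposition_singular_on[OF d N M _ A]
        lebesgue_decomposition_singular_on[OF d' N' M _ A] by simp
  qed
qed

lemma singular_part_eqI:
  "lebesgue_decomposition \<mu> \<alpha> \<sigma> \<Longrightarrow> singular_part \<mu> = \<sigma>"
  unfolding singular_part_def by (rule the_equality) (auto dest: lebesgue_decomposition_unique)

lemma lebesgue_decomposition_exists:
  assumes "sigma_finite_measure \<mu>" and s: "sets \<mu> = sets borel"
  shows "\<exists>\<alpha> \<sigma>. lebesgue_decomposition \<mu> \<alpha> \<sigma>"
proof -
  interpret sigma_finite_measure \<mu> by fact
  have sp: "space \<mu> = UNIV" using sets_eq_imp_space_eq[OF s] by simp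
  obtain h where h: "h \<in> borel_measurable \<mu>" "integral\<^sup>N \<mu> h \<noteq> \<infinity>"
      "\<And>x. x \<in> space \<mu> \<Longrightarrow> 0 < h x"
    using Ex_finite_integrable_function by blast
  define K where "K A = (\<integral>\<^sup>+x. h x * indicator A x \<partial>\<mu>)" for A
  have K_fin: "K A < \<infinity>" for A
  proof -
    have "K A \<le> integral\<^sup>N \<mu> h" unfolding K_def
      by (intro nn_integral_mono) (auto simp: indicator_def)
    then show ?thesis using h(2) by (simp add: top.not_eq_extremum le_less_trans)
  qed
  have K_mono: "A \<subseteq> B \<Longrightarrow> K A \<le> K B" for A B
    unfolding K_def by (intro nn_integral_mono) (auto simp: indicator_def)
  define u where "u = (SUP N\<in>null_sets lborel. K N)"
  obtain f where f: "range f \<subseteq> K ` null_sets lborel" "u = (SUP i::nat. f i)"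
    unfolding u_def
    using ennreal_SUP_countable_SUP[of "null_sets (lborel :: real measure)" K] emptyE
      null_sets.empty_sets[of "lborel :: real measure"] by blast
  then have "\<forall>i. \<exists>N\<in>null_sets lborel. f i = K N" by blast
  then obtain N where N: "\<And>i. N i \<in> null_sets lborel" "\<And>i. f i = K (N i)" by metis
  define M where "M = (\<Union>i. N i)"
  have M: "M \<in> null_sets lborel" unfolding M_def using N by auto
  then have "M \<in> sets borel" by (simp add: null_sets_def)
  then have Mb: "M \<in> sets \<mu>" "- M \<in> sets \<mu>"
    unfolding s by (simp_all add: borel_comp)
  have "u \<le> K M" unfolding f(2)
    by (intro SUP_least) (auto simp: N(2) M_def intro!: K_mono)
  have null: "emeasure \<mu> (A - M) = 0" if A: "A \<in> null_sets lborel" for A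
  proof -
    have Ab: "A \<in> sets \<mu>" using A unfolding s by (simp add: null_sets_def)
    have "K (A \<union> M) = K (A - M) + K M"
      unfolding K_def using h(1) Ab Mb
      by (subst nn_integral_add[symmetric]) (auto intro!: nn_integral_cong simp: indicator_def)
    moreover have "K (A \<union> M) \<le> u" unfolding u_def using A M by (intro SUP_upper) auto
    ultimately have "K (A - M) + K M \<le> K M" using \<open>u \<le> K M\<close> by (metis order_trans)
    then have "K M + K (A - M) \<le> K M + 0" by (simp only: add.commute add_0_right add_0_left)
    then have "K (A - M) = 0"
      using K_fin[of M] unfolding ennreal_add_left_cancel_le by auto
    then have "AE x in \<mu>. h x * indicator (A - M) x = 0"
      unfolding K_def using h(1) Ab Mb by (subst (asm) nn_integral_0_iff_AE) auto
    then have "AE x in \<mu>. x \<notin> A - M"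
      using AE_space by eventually_elim (use h(3) in \<open>force simp: indicator_def split: if_splits\<close>)
    then show ?thesis using Ab Mb by (subst (asm) AE_iff_measurable[of "A - M"]) (auto simp: sp)
  qed
  let ?\<alpha> = "density \<mu> (indicator (- M))" and ?\<sigma> = "density \<mu> (indicator M)"
  have e: "emeasure ?\<alpha> A = emeasure \<mu> (A - M)" "emeasure ?\<sigma> A = emeasure \<mu> (A \<inter> M)"
    if "A \<in> sets borel" for A
    using that Mb
    by (simp_all add: s emeasure_restricted Diff_eq Int_commute)
  have "lebesgue_decomposition \<mu> ?\<alpha> ?\<sigma>"
    unfolding lebesgue_decomposition_def
  proof (intro conjI ballI bexI[OF _ M])
    show "emeasure \<mu> A = emeasure ?\<alpha> A + emeasure ?\<sigma> A" if "A \<in> sets borel" for A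
    proof -
      have "(A - M) \<union> (A \<inter> M) = A" by auto
      moreover have "emeasure \<mu> (A - M) + emeasure \<mu> (A \<inter> M) = emeasure \<mu> ((A - M) \<union> (A \<inter> M))"
        using that Mb by (intro plus_emeasure) (auto simp: s)
      ultimately show ?thesis unfolding e[OF that] by simp
    qed
    show "absolutely_continuous lborel ?\<alpha>"
      unfolding absolutely_continuous_def
      using null e(1) by (auto simp: null_sets_def s)
    show "emeasure ?\<sigma> (- M) = 0"
      using e(2)[of "- M"] Mb by (simp add: s)
  qed (simp_all add: s)
  then show ?thesis by blast
qed

lemma herglotz_measure_sigma_finite:
  assumes "herglotz_measure \<mu>"
  shows "sigma_finite_measure \<mu>"
proof -
  have s: "sets \<mu> = sets borel" and i: "(\<integral>\<^sup>+ t. ennreal (1 / (t\<^sup>2 + 1)) \<partial>\<mu>) < \<infinity>"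
    using assms by (auto simp: herglotz_measure_def)
  have sp: "space \<mu> = UNIV" using sets_eq_imp_space_eq[OF s] by simp
  have fin: "emeasure \<mu> {- real n..real n} < \<infinity>" for n
  proof -
    have "emeasure \<mu> {- real n..real n} = (\<integral>\<^sup>+ t. indicator {- real n..real n} t \<partial>\<mu>)"
      using s by simp
    also have "\<dots> \<le> (\<integral>\<^sup>+ t. ennreal ((real n)\<^sup>2 + 1) * ennreal (1 / (t\<^sup>2 + 1)) \<partial>\<mu>)"
    proof (intro nn_integral_mono)
      fix t :: real
      have "t \<in> {- real n..real n} \<Longrightarrow> t\<^sup>2 \<le> (real n)\<^sup>2"
        by (metis abs_le_iff abs_le_square_iff abs_of_nat atLeastAtMost_iff minus_le_iff)
      then have "t \<in> {- real n..real n} \<Longrightarrow> 1 \<le> ((real n)\<^sup>2 + 1) * (1 / (t\<^sup>2 + 1))"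
        by (simp add: field_simps add_pos_nonneg sum_power2_gt_zero_iff)
      then show "indicator {- real n..real n} t
          \<le> ennreal ((real n)\<^sup>2 + 1) * ennreal (1 / (t\<^sup>2 + 1))"
        by (cases "t \<in> {- real n..real n}")
          (simp_all add: ennreal_mult[symmetric] del: ennreal_plus atLeastAtMost_iff)
    qed
    also have "\<dots> = ennreal ((real n)\<^sup>2 + 1) * (\<integral>\<^sup>+ t. ennreal (1 / (t\<^sup>2 + 1)) \<partial>\<mu>)"
      by (intro nn_integral_cmult) (simp add: measurable_cong_sets[OF s refl])
    also have "\<dots> < \<infinity>" using i by (simp add: ennreal_mult_less_top)
    finally show ?thesis .
  qed
  have cov: "(\<Union>n. {- real n..real n}) = UNIV"
  proof -
    have "\<exists>n. - real n \<le> x \<and> x \<le> real n" for x :: real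
    proof -
      obtain n where "\<bar>x\<bar> \<le> real n" using real_arch_simple by blast
      then show ?thesis by (intro exI[of _ n]) auto
    qed
    then show ?thesis by auto
  qed
  show ?thesis
    by standard (rule exI[of _ "range (\<lambda>n. {- real n..real n})"],
      use fin cov s sp in \<open>auto simp: less_top[symmetric]\<close>)
qed

lemma herglotz_measure_singular_part:
  assumes "herglotz_measure \<mu>"
  shows "\<exists>\<alpha>. lebesgue_decomposition \<mu> \<alpha> (singular_part \<mu>)"
  using lebesgue_decomposition_exists[OF herglotz_measure_sigma_finite[OF assms]] assms
    singular_part_eqI by (auto simp: herglotz_measure_def)

end

theory Submission
  imports Defs
begin

text \<open>
  Suppose \<open>\<mu>\<^sub>s(E) > 0\<close>. Since \<open>\<mu>\<^sub>s\<close> lives on a Lebesgue null set, there is a compact Lebesgue null set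
  \<open>K \<subseteq> E\<close> with \<open>\<mu>(K) > 0\<close>. Write \<open>F = F\<^sub>1 + F\<^sub>2\<close>, where \<open>F\<^sub>1\<close> is the Cauchy transform of the
  restriction of \<open>\<mu>\<close> to \<open>K\<close>. Weak homogeneity is contradicted as soon as \<open>E\<close> has density zero at some
  point of \<open>K\<close>. In fact almost every point \<open>x\<close> of \<open>K\<close> with respect to \<open>\<mu>\<close> has this property, because
  of two estimates for the size of \<open>|F|\<close> on \<open>E\<close> near \<open>x\<close>.

  The first says that \<open>|F|\<close> is small there. The restriction of \<open>\<mu>\<close> to \<open>K\<close> dominates both Lebesgue
  measure and the rest of \<open>\<mu>\<close> on small intervals around almost every \<open>x \<in> K\<close>
  (\<open>AE_relative_density_zero\<close>, a covering argument). Passing from intervals to Poisson kernels gives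
  \<open>Im F\<^sub>2(x + ih) = o(Im F(x + ih))\<close> as \<open>h \<rightarrow> 0\<close> (\<open>poisson_integral_negligible\<close>). Now \<open>Im F\<^sub>2\<close> is a
  positive harmonic function, and at almost every \<open>t \<in> E\<close> it has the same vertical limit as \<open>Im F\<close>,
  because \<open>Im F\<^sub>1\<close> tends to zero off \<open>K\<close>. As \<open>Re F(t) = 0\<close>, this limit is \<open>|F(t)|\<close>. So \<open>|F|\<close> is much
  smaller than \<open>m = Im F(x + ih)\<close>, on average over the part of \<open>E\<close> near \<open>x\<close> at scale \<open>h\<close>.

  The second says that it is not. The function \<open>i/F\<close> has positive real part, so the real part of its
  square root is a positive harmonic function comparable to \<open>|F|\<^sup>-\<^sup>1\<^sup>/\<^sup>2\<close>, and at \<open>x + ih\<close> it is at most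
  \<open>m\<^sup>-\<^sup>1\<^sup>/\<^sup>2\<close>. So \<open>|F|\<close> cannot be much smaller than \<open>m\<close> on a large part of the interval.

  The two estimates are combined in one positive harmonic function, \<open>Im F\<^sub>2/\<kappa>\<close> plus
  \<open>(2\<kappa>)\<^sup>1\<^sup>/\<^sup>2 Re (i/F)\<^sup>1\<^sup>/\<^sup>2\<close> with \<open>\<kappa> = \<theta>m\<close>. Its lower boundary limits are at least 1 almost everywhere
  on \<open>E\<close> (\<open>comparison_value_ge\<close>), while its value at \<open>x + ih\<close> is as small as desired if \<open>\<theta>\<close> and then
  \<open>h\<close> are small. By the mean value property and Fatou's lemma
  (\<open>lebesgue_measure_le_boundary_liminf\<close>) that value bounds the share of \<open>E\<close> in \<open>(x - h, x + h)\<close>, up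
  to a constant factor.
\<close>

section \<open>Boundary limits of positive harmonic functions\<close>

lemma circle_mean_value:
  fixes f :: "complex \<Rightarrow> complex"
  assumes "f holomorphic_on ball 0 1" "0 < r" "r < 1"
  shows "((\<lambda>s. f (of_real r * cis s)) has_integral 2 * of_real pi * f 0) {0..2 * pi}"
proof -
  have "f holomorphic_on cball 0 r"
    using assms by (auto intro: holomorphic_on_subset)
  then have "((\<lambda>u. f u / (u - 0)) has_contour_integral 2 * of_real pi * \<i> * f 0) (circlepath 0 r)"
    using assms by (intro Cauchy_integral_circlepath_simple) auto
  then have "((\<lambda>s. f (0 + of_real r * cis s) / (0 + of_real r * cis s - 0) * of_real r * \<i> * cis s)
      has_integral 2 * of_real pi * \<i> * f 0) {0..2 * pi}"
    unfolding circlepath_def by (subst (asm) has_contour_integral_part_circlepath_iff) auto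
  then have "((\<lambda>s. \<i> * f (of_real r * cis s)) has_integral \<i> * (2 * of_real pi * f 0)) {0..2 * pi}"
    using assms by (simp add: mult_ac)
  from has_integral_mult_right[OF this, of "- \<i>"] show ?thesis by (simp add: mult.assoc[symmetric])
qed

lemma cayley_in_half_plane:
  assumes "cmod w \<le> 1"
  shows "0 \<le> Im (\<i> * (1 + w) / (1 - w))"
proof -
  have "Im (\<i> * (1 + w) / (1 - w)) = (1 - (cmod w)\<^sup>2) / (cmod (1 - w))\<^sup>2"
    unfolding cmod_power2 by (simp add: Im_divide power2_eq_square algebra_simps)
  then show ?thesis using assms by (simp add: power_le_one)
qed

lemma cayley_on_circle:
  assumes "sin (s / 2) \<noteq> 0"
  shows "\<i> * (1 + cis s) / (1 - cis s) = of_real (- cot (s / 2))"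
proof -
  define a where "a = s / 2"
  have s: "s = 2 * a" by (simp add: a_def)
  have "sin a \<noteq> 0" using assms by (simp add: a_def)
  then have "1 - cos s \<noteq> 0" unfolding s cos_double_sin by simp
  then have "1 - cis s \<noteq> 0" by (auto simp: complex_eq_iff)
  moreover have "\<i> * (1 + cis s) = of_real (- cot a) * (1 - cis s)"
  proof -
    have "sin (2 * a) = cot a * (1 - cos (2 * a))"
      using \<open>sin a \<noteq> 0\<close> unfolding sin_double cos_double_sin by (simp add: cot_def power2_eq_square)
    moreover have "1 + cos (2 * a) = cot a * sin (2 * a)"
      using \<open>sin a \<noteq> 0\<close> unfolding sin_double cos_double_cos by (simp add: cot_def power2_eq_square)
    ultimately show ?thesis unfolding s by (simp add: complex_eq_iff)
  qed
  ultimately show ?thesis by (simp add: a_def divide_eq_eq)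
qed

text \<open>
  The Cayley map takes 0 to \<open>\<i>\<close> and the left half of the unit circle onto \<open>[-1, 1]\<close>, so the
  bound is the mean value property on the unit circle, restricted to an arc by positivity. The
  composition is singular at the boundary point 1, which maps to infinity; this is why the mean value
  property is first used on circles of radius \<open>r < 1\<close> and the limit \<open>r \<rightarrow> 1\<close> is taken on the
  left half circle only. The change of variables costs no constant, since the derivative of
  \<open>- cot (s / 2)\<close> is at most 1 on that arc.
\<close>

lemma half_plane_mean_unit:
  fixes G :: "complex \<Rightarrow> complex"
  assumes G: "G holomorphic_on {z. - d < Im z}" and d: "0 < d"
    and nonneg: "\<And>z. - d < Im z \<Longrightarrow> 0 \<le> Re (G z)"
  shows "integral {- 1..1} (\<lambda>t. Re (G (of_real t))) \<le> 2 * pi * Re (G \<i>)"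
proof -
  define \<phi> where "\<phi> w = \<i> * (1 + w) / (1 - w)" for w :: complex
  have im: "- d < Im (\<phi> w)" if "cmod w \<le> 1" for w
    using cayley_in_half_plane[OF that] d unfolding \<phi>_def by linarith
  define I where "I r = integral {pi / 2..3 * pi / 2} (\<lambda>s. Re (G (\<phi> (of_real r * cis s))))" for r
  have "G \<circ> \<phi> holomorphic_on ball 0 1"
  proof (rule holomorphic_on_compose_gen[OF _ G])
    show "\<phi> holomorphic_on ball 0 1"
      unfolding \<phi>_def by (intro holomorphic_intros) (auto simp: dist_norm)
    show "\<phi> ` ball 0 1 \<subseteq> {z. - d < Im z}" by (auto intro!: im)
  qed
  then have mv: "((\<lambda>s. G (\<phi> (of_real r * cis s))) has_integral 2 * of_real pi * G \<i>) {0..2 * pi}"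
    if "0 < r" "r < 1" for r
    using circle_mean_value[of "G \<circ> \<phi>" r] that by (simp add: \<phi>_def)
  have cos_neg: "cos s \<le> 0" if "s \<in> {pi / 2..3 * pi / 2}" for s
  proof -
    have "0 \<le> cos (s - pi)" using that by (intro cos_ge_zero) auto
    then show ?thesis by simp
  qed
  have cont: "continuous_on ({0..1} \<times> cbox (pi / 2) (3 * pi / 2))
      (\<lambda>(r, s). Re (G (\<phi> (of_real r * cis s))))"
  proof -
    have "1 - of_real r * cis s \<noteq> 0" if "r \<in> {0..1}" "s \<in> {pi / 2..3 * pi / 2}" for r s
    proof -
      have "r * cos s \<le> 0" using that cos_neg[of s] by (simp add: mult_nonneg_nonpos)
      then show ?thesis by (auto simp: complex_eq_iff)
    qed
    then have "continuous_on ({0..1} \<times> {pi / 2..3 * pi / 2}) (\<lambda>p. \<phi> (of_real (fst p) * cis (snd p)))"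
      unfolding \<phi>_def by (intro continuous_intros) auto
    then have "continuous_on ({0..1} \<times> {pi / 2..3 * pi / 2}) (\<lambda>p. G (\<phi> (of_real (fst p) * cis (snd p))))"
      by (rule continuous_on_compose2[OF holomorphic_on_imp_continuous_on[OF G]])
         (auto intro!: im simp: norm_mult)
    then show ?thesis by (auto simp: case_prod_unfold intro!: continuous_intros)
  qed
  have slice: "continuous_on {pi / 2..3 * pi / 2} (\<lambda>s. Re (G (\<phi> (of_real r * cis s))))"
    if "0 \<le> r" "r \<le> 1" for r
    using that by (intro continuous_on_compose2[OF cont, of _ "\<lambda>s. (r, s)", simplified])
      (auto intro!: continuous_intros)
  have contI: "continuous_on {0..1} I"
    using integral_continuous_on_param[OF cont] by (simp add: I_def)
  have "I r \<le> 2 * pi * Re (G \<i>)" if r: "0 < r" "r < 1" for r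
  proof -
    have full: "((\<lambda>s. Re (G (\<phi> (of_real r * cis s)))) has_integral 2 * pi * Re (G \<i>)) {0..2 * pi}"
      using has_integral_Re[OF mv[OF r]] by simp
    have "I r \<le> integral {0..2 * pi} (\<lambda>s. Re (G (\<phi> (of_real r * cis s))))"
      unfolding I_def using full slice[of r] r
      by (intro integral_subset_le)
        (auto intro!: nonneg im simp: norm_mult intro: integrable_continuous_interval has_integral_integrable)
    then show ?thesis using full by (simp add: integral_unique)
  qed
  then have I1: "I 1 \<le> 2 * pi * Re (G \<i>)"
    using contI by (intro continuous_le_on_closure[of "{0<..<1}" I 1]) auto
  define g where "g s = - cot (s / 2)" for s :: real
  have s_half: "1 / 2 \<le> (sin (s / 2))\<^sup>2" if "s \<in> {pi / 2..3 * pi / 2}" for s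
    using cos_neg[OF that] cos_double_sin[of "s / 2"] by simp
  have s_nz: "sin (s / 2) \<noteq> 0" if "s \<in> {pi / 2..3 * pi / 2}" for s
    using s_half[OF that] by auto
  have g_eq: "\<phi> (cis s) = of_real (g s)" if "s \<in> {pi / 2..3 * pi / 2}" for s
    using cayley_on_circle[OF s_nz[OF that]] by (simp add: \<phi>_def g_def)
  have contG: "continuous_on UNIV (\<lambda>t. Re (G (of_real t)))"
    using d by (intro continuous_intros continuous_on_compose2[OF holomorphic_on_imp_continuous_on[OF G]]) auto
  have ends: "g (pi / 2) = - 1" "g (3 * pi / 2) = 1"
  proof -
    have e: "3 * pi / 2 / 2 = pi / 4 + pi / 2" by simp
    show "g (pi / 2) = - 1" by (simp add: g_def cot_def sin_45 cos_45)
    show "g (3 * pi / 2) = 1"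
      unfolding g_def cot_def e sin_add cos_add by (simp add: sin_45 cos_45)
  qed
  have dg: "(g has_real_derivative (1 / (2 * (sin (s / 2))\<^sup>2))) (at s within {pi / 2..3 * pi / 2})"
    if "s \<in> {pi / 2..3 * pi / 2}" for s
  proof -
    have "(cot has_real_derivative - inverse ((sin (s / 2))\<^sup>2)) (at (s / 2))"
      by (rule DERIV_cot[OF s_nz[OF that]])
    moreover have "((\<lambda>s. s / 2) has_real_derivative 1 / 2) (at s within {pi / 2..3 * pi / 2})"
      by (auto intro!: derivative_eq_intros)
    ultimately have "((\<lambda>s. cot (s / 2)) has_real_derivative - inverse ((sin (s / 2))\<^sup>2) * (1 / 2))
        (at s within {pi / 2..3 * pi / 2})"
      by (rule DERIV_chain2)
    from DERIV_minus[OF this] show ?thesis unfolding g_def[abs_def] by (simp add: field_simps)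
  qed
  have contg: "continuous_on {pi / 2..3 * pi / 2} g"
    using dg by (rule DERIV_continuous_on)
  then have "compact (g ` {pi / 2..3 * pi / 2})" by (intro compact_continuous_image) auto
  then obtain B where "\<forall>y\<in>g ` {pi / 2..3 * pi / 2}. norm y \<le> B"
    by (meson compact_imp_bounded bounded_iff)
  then have B: "g ` {pi / 2..3 * pi / 2} \<subseteq> {- B..B}"
    by (intro subsetI) (metis abs_le_iff atLeastAtMost_iff minus_le_iff real_norm_def)
  have sub: "((\<lambda>s. (1 / (2 * (sin (s / 2))\<^sup>2)) *\<^sub>R Re (G (of_real (g s)))) has_integral
      integral {g (pi / 2)..g (3 * pi / 2)} (\<lambda>t. Re (G (of_real t)))) {pi / 2..3 * pi / 2}"
  proof (rule has_integral_substitution[OF _ _ B _ dg])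
    show "continuous_on {- B..B} (\<lambda>t. Re (G (of_real t)))"
      using contG by (rule continuous_on_subset) simp
    show "g (pi / 2) \<le> g (3 * pi / 2)" by (simp only: ends)
  qed simp
  have "integral {- 1..1} (\<lambda>t. Re (G (of_real t))) \<le> I 1"
    unfolding I_def
  proof (rule has_integral_le[OF sub[unfolded ends]])
    show "((\<lambda>s. Re (G (\<phi> (complex_of_real 1 * cis s)))) has_integral
       integral {pi / 2..3 * pi / 2} (\<lambda>s. Re (G (\<phi> (complex_of_real 1 * cis s))))) {pi / 2..3 * pi / 2}"
      by (intro integrable_integral integrable_continuous_interval slice) auto
    fix s assume s: "s \<in> {pi / 2..3 * pi / 2}"
    have "1 / (2 * (sin (s / 2))\<^sup>2) \<le> 1" using s_half[OF s] by (simp add: divide_le_eq_1)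
    moreover have "0 \<le> Re (G (of_real (g s)))" using d by (intro nonneg) simp
    ultimately have "(1 / (2 * (sin (s / 2))\<^sup>2)) * Re (G (of_real (g s))) \<le> 1 * Re (G (of_real (g s)))"
      by (rule mult_right_mono)
    then show "(1 / (2 * (sin (s / 2))\<^sup>2)) *\<^sub>R Re (G (of_real (g s))) \<le> Re (G (\<phi> (complex_of_real 1 * cis s)))"
      by (simp add: g_eq[OF s])
  qed
  with I1 show ?thesis by linarith
qed

lemma half_plane_mean:
  fixes Q :: "complex \<Rightarrow> complex"
  assumes Q: "Q holomorphic_on {z. 0 < Im z}" and nonneg: "\<And>z. 0 < Im z \<Longrightarrow> 0 \<le> Re (Q z)"
    and y: "0 < y" and \<delta>: "0 < \<delta>"
  shows "(\<integral>\<^sup>+t. ennreal (Re (Q (Complex t \<delta>))) * indicator {x - y..x + y} t \<partial>lborel)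
    \<le> ennreal (2 * pi * y * Re (Q (Complex x (y + \<delta>))))"
proof -
  \<comment> \<open>The affine map takes \<open>\<i>\<close> to \<open>x + i(y + \<delta>)\<close> and \<open>[-1, 1]\<close> to the interval at height \<open>\<delta>\<close>.\<close>
  define G where "G z = Q (Complex x \<delta> + of_real y * z)" for z
  have G_real: "G (of_real t) = Q (Complex (x + y * t) \<delta>)" for t
    unfolding G_def by (rule arg_cong[of _ _ Q]) (simp add: complex_eq_iff)
  have G_i: "G \<i> = Q (Complex x (y + \<delta>))"
    unfolding G_def by (rule arg_cong[of _ _ Q]) (simp add: complex_eq_iff)
  have im: "0 < Im (Complex x \<delta> + of_real y * z)" if "- (\<delta> / y) < Im z" for z
    using that y by (simp add: field_simps)
  have "(Q \<circ> (\<lambda>z. Complex x \<delta> + of_real y * z)) holomorphic_on {z. - (\<delta> / y) < Im z}"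
    using im by (intro holomorphic_on_compose_gen[OF _ Q] holomorphic_intros) auto
  then have G: "G holomorphic_on {z. - (\<delta> / y) < Im z}" by (simp add: G_def[abs_def] o_def)
  have mean: "integral {- 1..1} (\<lambda>t. Re (G (of_real t))) \<le> 2 * pi * Re (G \<i>)"
    using y \<delta> im by (intro half_plane_mean_unit[OF G]) (auto simp: G_def intro!: nonneg)
  have cont: "continuous_on UNIV (\<lambda>t. Re (Q (Complex t \<delta>)))"
    using \<delta> by (intro continuous_intros continuous_on_compose2[OF holomorphic_on_imp_continuous_on[OF Q]])
      (auto simp: Complex_eq intro!: continuous_intros)
  then have [measurable]: "(\<lambda>t. Re (Q (Complex t \<delta>))) \<in> borel_measurable borel"
    by (rule borel_measurable_continuous_onI)
  have contG: "continuous_on {- 1..1} (\<lambda>t. Re (G (of_real t)))"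
    unfolding G_real by (intro continuous_on_compose2[OF cont] continuous_intros) auto
  have "(\<integral>\<^sup>+t. ennreal (Re (Q (Complex t \<delta>))) * indicator {x - y..x + y} t \<partial>lborel)
      = \<bar>y\<bar> * (\<integral>\<^sup>+t. ennreal (Re (Q (Complex (x + y * t) \<delta>))) * indicator {x - y..x + y} (x + y * t) \<partial>lborel)"
    using y by (intro nn_integral_real_affine) auto
  also have "\<dots> = \<bar>y\<bar> * (\<integral>\<^sup>+t. ennreal (Re (G (of_real t))) * indicator {- 1..1} t \<partial>lborel)"
  proof -
    have "x + y * t \<in> {x - y..x + y} \<longleftrightarrow> t \<in> {- 1..1}" for t
      using y mult_le_cancel_left_pos[of y "- 1" t] mult_le_cancel_left_pos[of y t 1] by auto
    then show ?thesis by (simp only: G_real indicator_def)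
  qed
  also have "\<dots> = \<bar>y\<bar> * ennreal (integral {- 1..1} (\<lambda>t. Re (G (of_real t))))"
  proof -
    have "(\<integral>\<^sup>+t. ennreal (Re (G (of_real t))) * indicator {- 1..1} t \<partial>lborel)
        = ennreal (integral {- 1..1} (\<lambda>t. Re (G (of_real t))))"
      using \<delta> by (intro nn_integral_has_integral_lebesgue' integrable_integral
          integrable_continuous_interval contG) (auto simp: G_real intro!: nonneg)
    then show ?thesis by simp
  qed
  also have "\<dots> \<le> \<bar>y\<bar> * ennreal (2 * pi * Re (G \<i>))"
    using mean by (intro mult_left_mono ennreal_leI) auto
  also have "\<dots> = ennreal (2 * pi * y * Re (Q (Complex x (y + \<delta>))))"
    using y by (simp add: ennreal_mult'[symmetric] G_i mult_ac)
  finally show ?thesis .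
qed

text \<open>
  Fatou's lemma along the horizontal lines \<open>Im z = 1/(n+1)\<close>. The hypothesis speaks of lower
  vertical limits because the function to which this is applied contains a root of \<open>i/F\<close>, which
  blows up where \<open>F\<close> has boundary value zero.
\<close>

lemma lebesgue_measure_le_boundary_liminf:
  fixes Q :: "complex \<Rightarrow> complex"
  assumes Q: "Q holomorphic_on {z. 0 < Im z}" and nonneg: "\<And>z. 0 < Im z \<Longrightarrow> 0 \<le> Re (Q z)"
    and y: "0 < y" and A: "A \<in> sets borel" "A \<subseteq> {x - y..x + y}"
    and bd: "AE t in lborel. t \<in> A \<longrightarrow> (\<forall>c<1. \<forall>\<^sub>F \<delta> in at_right 0. c \<le> Re (Q (Complex t \<delta>)))"
  shows "measure lborel A \<le> 2 * pi * y * Re (Q (Complex x y))"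
proof -
  define \<delta> where "\<delta> n = 1 / real (Suc n)" for n
  have \<delta>0: "0 < \<delta> n" for n by (simp add: \<delta>_def)
  have \<delta>lim: "\<delta> \<longlonglongrightarrow> 0" unfolding \<delta>_def[abs_def] by (rule LIMSEQ_Suc[OF lim_1_over_n])
  have \<delta>right: "filterlim \<delta> (at_right 0) sequentially"
    unfolding filterlim_at using \<delta>lim \<delta>0 by (auto simp: less_imp_neq[symmetric])
  have cont: "continuous_on {z. 0 < Im z} (\<lambda>z. Re (Q z))"
    using Q by (intro continuous_intros holomorphic_on_imp_continuous_on)
  define u where "u n t = ennreal (Re (Q (Complex t (\<delta> n)))) * indicator A t" for n t
  have [measurable]: "(\<lambda>t. Re (Q (Complex t (\<delta> n)))) \<in> borel_measurable borel" for n
    using \<delta>0 by (intro borel_measurable_continuous_onI continuous_on_compose2[OF cont])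
      (auto simp: Complex_eq intro!: continuous_intros)
  have [measurable]: "u n \<in> borel_measurable lborel" for n
    using A(1) unfolding u_def by measurable
  have "AE t in lborel. indicator A t \<le> liminf (\<lambda>n. u n t)"
    using bd
  proof eventually_elim
    fix t assume t: "t \<in> A \<longrightarrow> (\<forall>c<1. \<forall>\<^sub>F \<delta> in at_right 0. c \<le> Re (Q (Complex t \<delta>)))"
    show "indicator A t \<le> liminf (\<lambda>n. u n t)"
    proof (cases "t \<in> A")
      case True
      have "\<forall>\<^sub>F n in sequentially. c < u n t" if c1: "c < 1" for c :: ennreal
      proof -
        obtain d where d: "c < d" "d < 1" using dense[OF c1] by auto
        define r where "r = enn2real d"
        have dr: "d = ennreal r" and r1: "r < 1" 
          using d(2) by (cases d rule: ennreal_cases; simp add: r_def ennreal_less_one_iff)+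
        have "\<forall>\<^sub>F n in sequentially. r \<le> Re (Q (Complex t (\<delta> n)))"
          using t True r1 \<delta>right by (auto intro: eventually_compose_filterlim)
        then show ?thesis
        proof eventually_elim
          fix n assume "r \<le> Re (Q (Complex t (\<delta> n)))"
          then show "c < u n t" using d(1) True dr by (auto simp: u_def intro: less_le_trans ennreal_leI)
        qed
      qed
      then show ?thesis using True by (simp add: le_Liminf_iff)
    qed simp
  qed
  then have "(\<integral>\<^sup>+t. indicator A t \<partial>lborel) \<le> (\<integral>\<^sup>+t. liminf (\<lambda>n. u n t) \<partial>lborel)"
    by (rule nn_integral_mono_AE)
  also have "\<dots> \<le> liminf (\<lambda>n. \<integral>\<^sup>+t. u n t \<partial>lborel)"
    by (rule nn_integral_liminf) measurable
  also have "\<dots> \<le> liminf (\<lambda>n. ennreal (2 * pi * y * Re (Q (Complex x (y + \<delta> n)))))"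
  proof (intro Liminf_mono always_eventually allI)
    fix n
    have "(\<integral>\<^sup>+t. u n t \<partial>lborel)
        \<le> (\<integral>\<^sup>+t. ennreal (Re (Q (Complex t (\<delta> n)))) * indicator {x - y..x + y} t \<partial>lborel)"
      using A(2) unfolding u_def by (intro nn_integral_mono) (auto simp: indicator_def)
    also have "\<dots> \<le> ennreal (2 * pi * y * Re (Q (Complex x (y + \<delta> n))))"
      by (rule half_plane_mean[OF Q nonneg y \<delta>0])
    finally show "(\<integral>\<^sup>+t. u n t \<partial>lborel) \<le> ennreal (2 * pi * y * Re (Q (Complex x (y + \<delta> n))))" .
  qed
  also have "\<dots> = ennreal (2 * pi * y * Re (Q (Complex x y)))"
  proof (rule lim_imp_Liminf)
    have "isCont (\<lambda>z. Re (Q z)) (Complex x y)"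
      using cont y by (auto simp: continuous_on_eq_continuous_at open_halfspace_Im_gt)
    moreover have "(\<lambda>n. Complex x (y + \<delta> n)) \<longlonglongrightarrow> Complex x y"
      using tendsto_add[OF tendsto_const \<delta>lim, of y] by (intro tendsto_Complex) auto
    ultimately have "(\<lambda>n. Re (Q (Complex x (y + \<delta> n)))) \<longlonglongrightarrow> Re (Q (Complex x y))"
      by (rule isCont_tendsto_compose)
    then show "(\<lambda>n. ennreal (2 * pi * y * Re (Q (Complex x (y + \<delta> n)))))
        \<longlonglongrightarrow> ennreal (2 * pi * y * Re (Q (Complex x y)))"
      by (intro tendsto_ennrealI tendsto_mult tendsto_const)
  qed simp
  finally have "emeasure lborel A \<le> ennreal (2 * pi * y * Re (Q (Complex x y)))"
    using A by simp
  then show ?thesis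
    using y nonneg[of "Complex x y"] by (simp add: measure_def enn2real_leI)
qed

section \<open>Differentiation of measures on the line\<close>

text \<open>
  A subfamily of least cardinality with the same union works: of three intervals through a
  common point, one lies in the union of the interval with the least left end and the interval with
  the greatest right end, so it could be dropped.
\<close>

lemma finite_intervals_overlap_two:
  fixes F :: "(real \<times> real) set"
  assumes "finite F"
  obtains G where "G \<subseteq> F" "(\<Union>(a, b)\<in>G. {a<..<b}) = (\<Union>(a, b)\<in>F. {a<..<b})"
    "\<And>t. card {(a, b) \<in> G. t \<in> {a<..<b}} \<le> 2"
proof -
  let ?U = "\<lambda>G. \<Union>(a, b)\<in>G. {a<..<b :: real}"
  let ?P = "\<lambda>G. G \<subseteq> F \<and> ?U G = ?U F"
  obtain G where G: "?P G" and min: "\<And>H. ?P H \<Longrightarrow> card G \<le> card H"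
    using ex_has_least_nat[of ?P F card] by auto
  have fin: "finite G" using G assms finite_subset by blast
  have "card {(a, b) \<in> G. t \<in> {a<..<b}} \<le> 2" for t
  proof (rule ccontr)
    define S where "S = {(a, b) \<in> G. t \<in> {a<..<b}}"
    assume "\<not> card {(a, b) \<in> G. t \<in> {a<..<b}} \<le> 2"
    then have card: "3 \<le> card S" by (simp add: S_def)
    have "finite S" using fin by (rule rev_finite_subset) (auto simp: S_def)
    have ne: "S \<noteq> {}" using card by auto
    have "Min (fst ` S) \<in> fst ` S" "Max (snd ` S) \<in> snd ` S"
      using \<open>finite S\<close> ne by (intro Min_in Max_in; simp)+
    then obtain p q where pq: "p \<in> S" "fst p = Min (fst ` S)" "q \<in> S" "snd q = Max (snd ` S)"
      by (metis imageE)
    have p: "p \<in> S" "\<And>s. s \<in> S \<Longrightarrow> fst p \<le> fst s" and q: "q \<in> S" "\<And>s. s \<in> S \<Longrightarrow> snd s \<le> snd q"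
      using pq \<open>finite S\<close> by auto
    have "card {p, q} \<le> 2" by (simp add: card_insert_if)
    then have "\<not> S \<subseteq> {p, q}" using card card_mono[of "{p, q}" S] by auto
    then obtain s where s: "s \<in> S" "s \<noteq> p" "s \<noteq> q" by auto
    have "{fst s<..<snd s} \<subseteq> {fst p<..<snd p} \<union> {fst q<..<snd q}"
    proof
      fix u assume u: "u \<in> {fst s<..<snd s}"
      have "t < snd p" "fst q < t" using p(1) q(1) by (auto simp: S_def)
      then show "u \<in> {fst p<..<snd p} \<union> {fst q<..<snd q}"
        using u p(2)[OF s(1)] q(2)[OF s(1)] by (cases "u \<le> t") auto
    qed
    moreover have in_G: "p \<in> G - {s}" "q \<in> G - {s}" "s \<in> G" using p q s by (auto simp: S_def)
    ultimately have "{fst s<..<snd s} \<subseteq> ?U (G - {s})" unfolding case_prod_unfold by blast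
    moreover have "?U G = {fst s<..<snd s} \<union> ?U (G - {s})"
      using UN_insert[of "\<lambda>(a, b). {a<..<b}" s "G - {s}"] insert_Diff[OF in_G(3)]
      by (simp only: case_prod_unfold)
    ultimately have "?U G \<subseteq> ?U (G - {s})" by blast
    then have "?U (G - {s}) = ?U F" using G by blast
    then have "card G \<le> card (G - {s})" using G by (intro min) auto
    then show False using fin in_G(3) card_Diff1_less[of G s] by linarith
  qed
  with G that show thesis by blast
qed

lemma finite_covering_estimate:
  fixes M \<nu> :: "real measure"
  assumes s: "sets M = sets borel" "sets \<nu> = sets borel" and F: "finite F"
    and U: "U \<in> sets borel" "\<And>a b. (a, b) \<in> F \<Longrightarrow> {a<..<b} \<subseteq> U"
    and le: "\<And>a b. (a, b) \<in> F \<Longrightarrow> c * emeasure M {a<..<b} \<le> emeasure \<nu> {a<..<b}"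
  shows "c * emeasure M (\<Union>(a, b)\<in>F. {a<..<b}) \<le> 2 * emeasure \<nu> U"
proof -
  obtain G where G: "G \<subseteq> F" "(\<Union>(a, b)\<in>G. {a<..<b}) = (\<Union>(a, b)\<in>F. {a<..<b})"
    and two: "\<And>t. card {(a, b) \<in> G. t \<in> {a<..<b}} \<le> 2"
    using finite_intervals_overlap_two[OF F] by blast
  have fin: "finite G" using G F finite_subset by blast
  have "emeasure M (\<Union>p\<in>G. {fst p<..<snd p}) \<le> (\<Sum>p\<in>G. emeasure M {fst p<..<snd p})"
    by (intro emeasure_subadditive_finite fin) (simp add: s image_subset_iff)
  then have "c * emeasure M (\<Union>p\<in>G. {fst p<..<snd p}) \<le> c * (\<Sum>p\<in>G. emeasure M {fst p<..<snd p})"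
    by (rule mult_left_mono) simp
  also have "\<dots> \<le> (\<Sum>p\<in>G. emeasure \<nu> {fst p<..<snd p})"
    unfolding sum_distrib_left using G(1) by (intro sum_mono le) auto
  also have "\<dots> = (\<Sum>p\<in>G. \<integral>\<^sup>+t. indicator {fst p<..<snd p} t \<partial>\<nu>)"
    using s by (intro sum.cong refl) simp
  also have "\<dots> = (\<integral>\<^sup>+t. (\<Sum>p\<in>G. indicator {fst p<..<snd p} t) \<partial>\<nu>)"
    using s by (intro nn_integral_sum[symmetric]) auto
  also have "\<dots> \<le> (\<integral>\<^sup>+t. 2 * indicator U t \<partial>\<nu>)"
  proof (rule nn_integral_mono)
    fix t
    have "(\<Sum>p\<in>G. indicator {fst p<..<snd p} t :: ennreal)
        = of_nat (card {p \<in> G. t \<in> {fst p<..<snd p}})"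
      using fin by (simp add: indicator_def sum.If_cases Int_def del: greaterThanLessThan_iff)
    also have "\<dots> \<le> 2 * indicator U t"
    proof (cases "t \<in> U")
      case True
      have "{p \<in> G. t \<in> {fst p<..<snd p}} = {(a, b) \<in> G. t \<in> {a<..<b}}" by auto
      then have "card {p \<in> G. t \<in> {fst p<..<snd p}} \<le> 2" using two[of t] by simp
      then have "of_nat (card {p \<in> G. t \<in> {fst p<..<snd p}}) \<le> (of_nat 2 :: ennreal)"
        by (simp only: of_nat_le_iff)
      then show ?thesis using True by simp
    next
      case False
      then have "{p \<in> G. t \<in> {fst p<..<snd p}} = {}" using U(2) G(1) by force
      then show ?thesis by (simp only: card.empty) simp
    qed
    finally show "(\<Sum>p\<in>G. indicator {fst p<..<snd p} t) \<le> 2 * (indicator U t :: ennreal)" .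
  qed
  also have "\<dots> = 2 * emeasure \<nu> U" using U s by (simp add: nn_integral_cmult)
  finally show ?thesis using G(2) by (simp add: case_prod_unfold)
qed

text \<open>
  Inner regularity and compactness reduce an arbitrary family of intervals to a finite one.
  The family may be uncountable, with a set of centres that is not measurable, since only the open
  union is measured.
\<close>

lemma covering_estimate:
  fixes M \<nu> :: "real measure"
  assumes s: "sets M = sets borel" "sets \<nu> = sets borel" and fin: "emeasure M (space M) \<noteq> \<infinity>"
    and U: "U \<in> sets borel" "\<And>a b. (a, b) \<in> P \<Longrightarrow> {a<..<b} \<subseteq> U"
    and le: "\<And>a b. (a, b) \<in> P \<Longrightarrow> c * emeasure M {a<..<b} \<le> emeasure \<nu> {a<..<b}"
  shows "c * emeasure M (\<Union>(a, b)\<in>P. {a<..<b}) \<le> 2 * emeasure \<nu> U"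
proof -
  let ?O = "\<Union>(a, b)\<in>P. {a<..<b}"
  have "c * emeasure M K \<le> 2 * emeasure \<nu> U" if K: "compact K" "K \<subseteq> ?O" for K
  proof -
    have "open {fst p<..<snd p}" for p :: "real \<times> real" by simp
    then obtain F where F: "F \<subseteq> P" "finite F" "K \<subseteq> (\<Union>p\<in>F. {fst p<..<snd p})"
      using compactE_image[OF K(1), of P "\<lambda>p. {fst p<..<snd p}"] K(2) by (auto simp: case_prod_unfold)
    have "c * emeasure M K \<le> c * emeasure M (\<Union>(a, b)\<in>F. {a<..<b})"
      using F s by (intro mult_left_mono emeasure_mono) (auto simp: case_prod_unfold)
    also have "\<dots> \<le> 2 * emeasure \<nu> U"
      using F U le by (intro finite_covering_estimate s) blast+
    finally show ?thesis .
  qed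
  moreover have "open ?O" by auto
  then have "emeasure M ?O = (SUP K\<in>{K. K \<subseteq> ?O \<and> compact K}. emeasure M K)"
    by (intro inner_regular s fin) simp
  ultimately show ?thesis
    by (auto simp: SUP_mult_left_ennreal intro!: SUP_least)
qed

lemma open_neighbourhood_small:
  fixes \<nu> :: "real measure"
  assumes s: "sets \<nu> = sets borel" and fin: "\<And>a b. emeasure \<nu> {a..b} < \<infinity>"
    and K: "compact K" "emeasure \<nu> K = 0" and e: "0 < e"
  obtains U where "open U" "K \<subseteq> U" "emeasure \<nu> U < e"
proof (cases "K = {}")
  case True
  with e show thesis by (intro that[of "{}"]) simp_all
next
  case False
  define U where "U n = {t. infdist t K < 1 / real (Suc n)}" for n
  have op: "open (U n)" for n
    unfolding U_def by (intro open_Collect_less continuous_intros)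
  have sub: "K \<subseteq> U n" for n by (auto simp: U_def)
  have "decseq U"
  proof (rule decseq_SucI)
    fix n
    have "1 / real (Suc (Suc n)) \<le> 1 / real (Suc n)" by (simp add: frac_le)
    then show "U (Suc n) \<subseteq> U n" unfolding U_def by auto
  qed
  moreover have "emeasure \<nu> (U n) \<noteq> \<infinity>" for n
  proof -
    obtain B where B: "\<And>k. k \<in> K \<Longrightarrow> \<bar>k\<bar> \<le> B"
      using compact_imp_bounded[OF K(1)] by (auto simp: bounded_iff)
    have "U n \<subseteq> {- (B + 1)..B + 1}"
    proof
      fix t assume "t \<in> U n"
      moreover obtain k where k: "k \<in> K" "infdist t K = dist t k"
        using infdist_attains_inf[OF compact_imp_closed[OF K(1)] False] by blast
      ultimately have "dist t k < 1 / real (Suc n)"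
        by (simp add: U_def)
      then have "dist t k < 1" by (rule less_le_trans) (simp add: divide_le_eq_1)
      then show "t \<in> {- (B + 1)..B + 1}" using B[OF k(1)] by (auto simp: dist_real_def)
    qed
    then have "emeasure \<nu> (U n) \<le> emeasure \<nu> {- (B + 1)..B + 1}"
      using s by (intro emeasure_mono) auto
    then have "emeasure \<nu> (U n) < \<infinity>" using fin by (rule le_less_trans)
    then show ?thesis by simp
  qed
  moreover have "(\<Inter>n. U n) = K"
  proof
    show "(\<Inter>n. U n) \<subseteq> K"
    proof
      fix t assume t: "t \<in> (\<Inter>n. U n)"
      have "infdist t K \<le> 0"
      proof (rule ccontr)
        assume "\<not> infdist t K \<le> 0"
        then obtain n where "1 / real (Suc n) < infdist t K"
          using nat_approx_posE[of "infdist t K"] by auto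
        with t show False unfolding U_def by (auto simp: less_le_not_le)
      qed
      then show "t \<in> K"
        using in_closed_iff_infdist_zero[OF compact_imp_closed[OF K(1)] False] infdist_nonneg[of t K]
        by auto
    qed
  qed (use sub in auto)
  ultimately have "(\<lambda>n. emeasure \<nu> (U n)) \<longlonglongrightarrow> emeasure \<nu> K"
    using Lim_emeasure_decseq[of U \<nu>] op s by (auto intro!: borel_open)
  then have "\<forall>\<^sub>F n in sequentially. emeasure \<nu> (U n) < e"
    unfolding K(2) using e by (rule order_tendstoD)
  then obtain n where "emeasure \<nu> (U n) < e" using eventually_sequentially by auto
  then show thesis using that op sub by blast
qed

text \<open>
  A differentiation theorem for measures that need not be doubling. The points of \<open>K\<close> where the
  conclusion fails for a given \<open>c\<close> are covered by intervals inside any neighbourhood \<open>U\<close> of \<open>K\<close> on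
  which \<open>\<nu>\<close> exceeds \<open>c\<close> times \<open>M\<close>. By the covering estimate, the \<open>M\<close>-measure of their union is at
  most \<open>(2 / c) \<nu>(U)\<close>, which is small because \<open>\<nu>(K) = 0\<close>.
\<close>

lemma AE_relative_density_zero:
  fixes M \<nu> :: "real measure"
  assumes s: "sets M = sets borel" "sets \<nu> = sets borel" and finM: "emeasure M (space M) \<noteq> \<infinity>"
    and fin: "\<And>a b. emeasure \<nu> {a..b} < \<infinity>"
    and K: "compact K" "emeasure \<nu> K = 0"
  shows "AE x in M. x \<in> K \<longrightarrow> (\<forall>c>0. \<forall>\<^sub>F r in at_right 0.
      emeasure \<nu> {x - r<..<x + r} \<le> ennreal c * emeasure M {x - r<..<x + r})"
proof -
  define c where "c n = 1 / real (Suc n)" for n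
  have c0: "0 < c n" for n by (simp add: c_def)
  define good where "good d x \<longleftrightarrow> (\<forall>\<^sub>F r in at_right 0.
      emeasure \<nu> {x - r<..<x + r} \<le> ennreal d * emeasure M {x - r<..<x + r})" for d x
  have ex: "\<exists>V. open V \<and> {x \<in> K. \<not> good (c n) x} \<subseteq> V \<and> emeasure M V \<le> ennreal (c j)" for n j
  proof -
    \<comment> \<open>The factor 2 of the covering estimate and the threshold \<open>c n\<close> then leave exactly \<open>c j\<close>.\<close>
    obtain U where U: "open U" "K \<subseteq> U" "emeasure \<nu> U < ennreal (c n * c j / 2)"
      by (rule open_neighbourhood_small[OF s(2) fin K]) (auto simp: c0)
    define P where "P = {(a, b). {a<..<b} \<subseteq> U \<and> 
      ennreal (c n) * emeasure M {a<..<b} \<le> emeasure \<nu> {a<..<b}}"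
    let ?V = "\<Union>(a, b)\<in>P. {a<..<b}"
    have "ennreal (c n) * emeasure M ?V \<le> 2 * emeasure \<nu> U"
      using U(1) by (intro covering_estimate s finM) (auto simp: P_def)
    also have "\<dots> \<le> 2 * ennreal (c n * c j / 2)"
      using U(3) by (intro mult_left_mono) auto
    also have "\<dots> = ennreal (c n) * ennreal (c j)"
    proof -
      have "2 * ennreal (c n * c j / 2) = ennreal 2 * ennreal (c n * c j / 2)" by simp
      also have "\<dots> = ennreal (c n * c j)"
        using c0[of n] c0[of j] by (subst ennreal_mult[symmetric]) auto
      finally show ?thesis using c0[of n] c0[of j] by (simp add: ennreal_mult)
    qed
    finally have "emeasure M ?V \<le> ennreal (c j)"
      using c0[of n] by (subst (asm) ennreal_mult_le_mult_iff) auto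
    moreover have "{x \<in> K. \<not> good (c n) x} \<subseteq> ?V"
    proof
      fix x assume x: "x \<in> {x \<in> K. \<not> good (c n) x}"
      then have "x \<in> U" using U(2) by blast
      then obtain e where e: "0 < e" "ball x e \<subseteq> U" using U(1) openE by blast
      have "\<exists>\<^sub>F r in at_right 0. \<not> emeasure \<nu> {x - r<..<x + r} \<le> ennreal (c n) * emeasure M {x - r<..<x + r}"
        using x by (auto simp: good_def frequently_def)
      moreover have "\<forall>\<^sub>F r in at_right 0. r \<in> {0<..<e}"
        using e by (intro eventually_at_right_real)
      ultimately obtain r where r: "r \<in> {0<..<e}"
        "\<not> emeasure \<nu> {x - r<..<x + r} \<le> ennreal (c n) * emeasure M {x - r<..<x + r}"
        using frequently_ex[OF frequently_eventually_frequently] by blast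
      have "{x - r<..<x + r} \<subseteq> ball x e" using r(1) by (auto simp: dist_real_def)
      then have "(x - r, x + r) \<in> P" using r(2) e by (auto simp: P_def)
      moreover have "x \<in> {x - r<..<x + r}" using r by auto
      ultimately show "x \<in> ?V" by blast
    qed
    moreover have "open ?V" by auto
    ultimately show ?thesis by blast
  qed
  then obtain V where V: "\<And>n j. open (V n j)" "\<And>n j. {x \<in> K. \<not> good (c n) x} \<subseteq> V n j"
    "\<And>n j. emeasure M (V n j) \<le> ennreal (c j)"
    by metis
  define N where "N n = (\<Inter>j. V n j)" for n
  have "N n \<in> null_sets M" for n
  proof -
    have b: "N n \<in> sets M" unfolding N_def s using V(1) by auto
    have "emeasure M (N n) \<le> ennreal (c j)" for j
      using V(1,3)[of n j] s by (intro order_trans[OF emeasure_mono V(3)[of n j]]) (auto simp: N_def)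
    moreover have "(\<lambda>j. ennreal (c j)) \<longlonglongrightarrow> ennreal 0"
      unfolding c_def by (intro tendsto_ennrealI LIMSEQ_Suc[OF lim_1_over_n])
    ultimately have "emeasure M (N n) \<le> ennreal 0"
      by (intro tendsto_lowerbound[of _ _ sequentially]) auto
    then show ?thesis using b by auto
  qed
  then have null: "(\<Union>n. N n) \<in> null_sets M" by auto
  have "good d x" if "x \<in> K" "x \<notin> (\<Union>n. N n)" and d: "0 < d" for d x
  proof -
    have g: "good (c n) x" for n using that V(2)[of n] by (auto simp: N_def)
    obtain n where n: "c n < d" using nat_approx_posE[OF d] unfolding c_def by blast
    show ?thesis using g[of n] unfolding good_def
    proof eventually_elim
      case (elim r)
      also have "ennreal (c n) * emeasure M {x - r<..<x + r} \<le> ennreal d * emeasure M {x - r<..<x + r}"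
        using n by (intro mult_right_mono ennreal_leI) auto
      finally show ?case .
    qed
  qed
  then have "{x \<in> space M. \<not> (x \<in> K \<longrightarrow> (\<forall>d>0. good d x))} \<subseteq> (\<Union>n. N n)" by blast
  with null have "AE x in M. x \<in> K \<longrightarrow> (\<forall>d>0. good d x)" by (rule AE_I')
  then show ?thesis by (simp only: good_def)
qed

text \<open>
  By the layer cake formula, the integral of \<open>g\<close> sums up the measures of its level sets, and
  these are intervals on which the two measures are compared.
\<close>

lemma nn_integral_mono_centered_intervals:
  fixes A B :: "real measure" and g :: "real \<Rightarrow> real"
  assumes sf: "sigma_finite_measure A" "sigma_finite_measure B"
    and s: "sets A = sets borel" "sets B = sets borel"
    and g: "g \<in> borel_measurable borel" "\<And>t. 0 \<le> g t"
    and level: "\<And>\<tau>. 0 < \<tau> \<Longrightarrow> \<exists>u. {t. \<tau> < g t} = {x - u<..<x + u}"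
    and le: "\<And>r. 0 < r \<Longrightarrow> r \<le> r0 \<Longrightarrow> emeasure A {x - r<..<x + r} \<le> emeasure B {x - r<..<x + r}"
  shows "(\<integral>\<^sup>+t. ennreal (g t) * indicator {x - r0<..<x + r0} t \<partial>A)
    \<le> (\<integral>\<^sup>+t. ennreal (g t) * indicator {x - r0<..<x + r0} t \<partial>B)"
proof -
  let ?I = "{x - r0<..<x + r0}"
  let ?L = "\<lambda>\<tau>. {t. \<tau> < g t} \<inter> ?I"
  note g(1)[measurable]
  have cake: "(\<integral>\<^sup>+t. ennreal (g t) * indicator ?I t \<partial>C)
      = (\<integral>\<^sup>+\<tau>. indicator {0<..} \<tau> * emeasure C (?L \<tau>) \<partial>lborel)"
    if sf: "sigma_finite_measure C" and s: "sets C = sets borel" for C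
  proof -
    interpret C: sigma_finite_measure C by fact
    interpret pair_sigma_finite C "lborel :: real measure" ..
    note s[measurable_cong]
    have "(\<integral>\<^sup>+t. ennreal (g t) * indicator ?I t \<partial>C)
        = (\<integral>\<^sup>+t. (\<integral>\<^sup>+\<tau>. indicator {0<..} \<tau> * indicator (?L \<tau>) t \<partial>lborel) \<partial>C)"
    proof (rule nn_integral_cong)
      fix t
      have "(\<integral>\<^sup>+\<tau>. indicator {0<..} \<tau> * indicator (?L \<tau>) t \<partial>lborel)
          = (\<integral>\<^sup>+\<tau>. indicator ?I t * indicator {0<..<g t} \<tau> \<partial>lborel)"
        by (intro nn_integral_cong) (auto simp: indicator_def)
      also have "\<dots> = ennreal (g t) * indicator ?I t"
        using g(2)[of t] by (subst nn_integral_cmult) (auto simp: mult.commute)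
      finally show "ennreal (g t) * indicator ?I t
          = (\<integral>\<^sup>+\<tau>. indicator {0<..} \<tau> * indicator (?L \<tau>) t \<partial>lborel)" ..
    qed
    also have "\<dots> = (\<integral>\<^sup>+\<tau>. (\<integral>\<^sup>+t. indicator {0<..} \<tau> * indicator (?L \<tau>) t \<partial>C) \<partial>lborel)"
      by (rule Fubini'[symmetric]) (simp add: indicator_def, measurable)
    also have "\<dots> = (\<integral>\<^sup>+\<tau>. indicator {0<..} \<tau> * emeasure C (?L \<tau>) \<partial>lborel)"
      by (intro nn_integral_cong) (simp add: nn_integral_cmult s)
    finally show ?thesis .
  qed
  have "indicator {0<..} \<tau> * emeasure A (?L \<tau>) \<le> indicator {0<..} \<tau> * emeasure B (?L \<tau>)" for \<tau>
  proof (cases "0 < \<tau>")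
    case True
    then obtain u where u: "{t. \<tau> < g t} = {x - u<..<x + u}" using level by blast
    then have L: "?L \<tau> = {x - min u r0<..<x + min u r0}" by auto
    have "emeasure A (?L \<tau>) \<le> emeasure B (?L \<tau>)"
    proof (cases "0 < min u r0")
      case True
      then show ?thesis unfolding L by (intro le) auto
    next
      case False
      then have "?L \<tau> = {}" unfolding L by (intro greaterThanLessThan_empty) linarith
      then show ?thesis by (simp only: emeasure_empty)
    qed
    then show ?thesis by (intro mult_left_mono) auto
  qed simp
  then show ?thesis using sf s by (simp add: cake nn_integral_mono)
qed

section \<open>Cauchy transforms and the Herglotz representation\<close>

lemma Im_inverse_shift: "Im (1 / (of_real t - z)) = Im z / ((t - Re z)\<^sup>2 + (Im z)\<^sup>2)"
  by (simp add: Im_divide)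

lemma Im_le_cmod_shift: "Im z \<le> cmod (of_real t - z)"
  using abs_Im_le_cmod[of "of_real t - z"] by simp

lemma herglotz_measure_Icc_finite:
  assumes "herglotz_measure \<mu>"
  shows "emeasure \<mu> {a..b} < \<infinity>"
proof -
  have s: "sets \<mu> = sets borel" and fin: "(\<integral>\<^sup>+ t. ennreal (1 / (t\<^sup>2 + 1)) \<partial>\<mu>) < \<infinity>"
    using assms by (auto simp: herglotz_measure_def)
  note s[measurable_cong]
  define B where "B = max \<bar>a\<bar> \<bar>b\<bar>"
  have "emeasure \<mu> {a..b} = (\<integral>\<^sup>+ t. indicator {a..b} t \<partial>\<mu>)" by (simp add: s)
  also have "\<dots> \<le> (\<integral>\<^sup>+ t. ennreal (B\<^sup>2 + 1) * ennreal (1 / (t\<^sup>2 + 1)) \<partial>\<mu>)"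
  proof (rule nn_integral_mono)
    fix t
    have "indicator {a..b} t \<le> (B\<^sup>2 + 1) * (1 / (t\<^sup>2 + 1))"
    proof (cases "t \<in> {a..b}")
      case True
      then have "\<bar>t\<bar> \<le> \<bar>B\<bar>" by (auto simp: B_def)
      then have "t\<^sup>2 \<le> B\<^sup>2" by (simp add: abs_le_square_iff)
      moreover have "0 < t\<^sup>2 + 1" by (simp add: add_nonneg_pos)
      ultimately show ?thesis using True by (simp add: le_divide_eq)
    qed (simp add: add_nonneg_nonneg)
    then have "ennreal (indicator {a..b} t) \<le> ennreal ((B\<^sup>2 + 1) * (1 / (t\<^sup>2 + 1)))"
      by (rule ennreal_leI)
    then show "indicator {a..b} t \<le> ennreal (B\<^sup>2 + 1) * ennreal (1 / (t\<^sup>2 + 1))"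
      by (subst (asm) ennreal_mult) (simp_all add: ennreal_indicator add_nonneg_nonneg)
  qed
  also have "\<dots> = ennreal (B\<^sup>2 + 1) * (\<integral>\<^sup>+ t. ennreal (1 / (t\<^sup>2 + 1)) \<partial>\<mu>)"
    by (intro nn_integral_cmult) measurable
  also have "\<dots> < \<infinity>" using fin by (simp add: ennreal_mult_less_top)
  finally show ?thesis .
qed

text \<open>
  The difference is \<open>(1 + tz) / ((t - z)(t\<^sup>2 + 1))\<close>, and \<open>1 + tz = (1 + z\<^sup>2) + z(t - z)\<close>.
\<close>

lemma herglotz_kernel_bound:
  assumes "0 < Im z"
  shows "cmod (1 / (of_real t - z) - of_real (t / (t\<^sup>2 + 1)))
    \<le> (cmod (1 + z\<^sup>2) / Im z + cmod z) * (1 / (t\<^sup>2 + 1))"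
proof -
  let ?w = "of_real t - z"
  have w: "Im z \<le> cmod ?w" by (rule Im_le_cmod_shift)
  then have nz: "?w \<noteq> 0" using assms by auto
  have t: "0 < t\<^sup>2 + 1" by (simp add: add_nonneg_pos)
  then have "complex_of_real (t\<^sup>2 + 1) \<noteq> 0" by (simp only: of_real_eq_0_iff)
  then have "1 / ?w - of_real (t / (t\<^sup>2 + 1)) = ((1 + z\<^sup>2) / ?w + z) * of_real (1 / (t\<^sup>2 + 1))"
    using nz unfolding of_real_divide by (simp add: field_simps) (simp add: algebra_simps power2_eq_square)
  also have "cmod \<dots> = cmod ((1 + z\<^sup>2) / ?w + z) * (1 / (t\<^sup>2 + 1))"
    using t by (simp only: norm_mult norm_of_real) simp
  also have "\<dots> \<le> (cmod (1 + z\<^sup>2) / Im z + cmod z) * (1 / (t\<^sup>2 + 1))"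
  proof (rule mult_right_mono)
    have "cmod ((1 + z\<^sup>2) / ?w + z) \<le> cmod (1 + z\<^sup>2) / cmod ?w + cmod z"
      using norm_triangle_ineq[of "(1 + z\<^sup>2) / ?w" z] by (simp add: norm_divide)
    also have "\<dots> \<le> cmod (1 + z\<^sup>2) / Im z + cmod z"
      using w assms by (intro add_right_mono divide_left_mono mult_pos_pos) auto
    finally show "cmod ((1 + z\<^sup>2) / ?w + z) \<le> cmod (1 + z\<^sup>2) / Im z + cmod z" .
  qed (use t in simp)
  finally show ?thesis .
qed

lemma Im_herglotz_rep:
  assumes \<mu>: "herglotz_measure \<mu>" and z: "0 < Im z" and b: "0 \<le> b"
  shows "ennreal (Im (herglotz_rep a b \<mu> z))
    = ennreal (b * Im z) + (\<integral>\<^sup>+t. ennreal (Im z / ((t - Re z)\<^sup>2 + (Im z)\<^sup>2)) \<partial>\<mu>)"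
proof -
  have s[measurable_cong]: "sets \<mu> = sets borel" and fin: "(\<integral>\<^sup>+ t. ennreal (1 / (t\<^sup>2 + 1)) \<partial>\<mu>) < \<infinity>"
    using \<mu> by (auto simp: herglotz_measure_def)
  let ?f = "\<lambda>t. 1 / (of_real t - z) - of_real (t / (t\<^sup>2 + 1))"
  have "integrable \<mu> (\<lambda>t. 1 / (t\<^sup>2 + 1))"
    using fin by (intro integrableI_nonneg) (auto simp: add_nonneg_nonneg)
  then have "integrable \<mu> (\<lambda>t. (cmod (1 + z\<^sup>2) / Im z + cmod z) * (1 / (t\<^sup>2 + 1)))"
    by (rule integrable_mult_right)
  then have int: "integrable \<mu> ?f"
  proof (rule Bochner_Integration.integrable_bound)
    show "AE t in \<mu>. norm (?f t) \<le> norm ((cmod (1 + z\<^sup>2) / Im z + cmod z) * (1 / (t\<^sup>2 + 1)))"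
      unfolding real_norm_def by (intro AE_I2 order_trans[OF herglotz_kernel_bound[OF z] abs_ge_self])
  qed measurable
  have Imf: "Im (?f t) = Im z / ((t - Re z)\<^sup>2 + (Im z)\<^sup>2)" for t
    by (simp only: minus_complex.sel Im_inverse_shift Im_complex_of_real diff_zero)
  have intIm: "integrable \<mu> (\<lambda>t. Im z / ((t - Re z)\<^sup>2 + (Im z)\<^sup>2))"
    using integrable_Im[OF int] by (simp only: Imf)
  have "Im (LINT t|\<mu>. ?f t) = (LINT t|\<mu>. Im z / ((t - Re z)\<^sup>2 + (Im z)\<^sup>2))"
    using integral_Im[OF int] by (simp only: Imf)
  moreover have "Im (herglotz_rep a b \<mu> z) = b * Im z + Im (LINT t|\<mu>. ?f t)"
    unfolding herglotz_rep_def by simp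
  moreover have "ennreal (LINT t|\<mu>. Im z / ((t - Re z)\<^sup>2 + (Im z)\<^sup>2))
      = (\<integral>\<^sup>+t. ennreal (Im z / ((t - Re z)\<^sup>2 + (Im z)\<^sup>2)) \<partial>\<mu>)"
    using intIm z by (intro nn_integral_eq_integral[symmetric]) auto
  ultimately show ?thesis
    using b z by (simp add: ennreal_plus integral_nonneg_AE)
qed

lemma cauchy_kernel_integrable:
  assumes s: "sets M = sets borel" and fin: "finite_measure M" and z: "0 < Im z"
  shows "integrable M (\<lambda>t. 1 / (of_real t - z) ^ n)"
proof -
  interpret finite_measure M by fact
  note s[measurable_cong]
  show ?thesis
  proof (rule integrable_const_bound)
    show "AE t in M. norm (1 / (of_real t - z) ^ n) \<le> 1 / Im z ^ n"
    proof (intro AE_I2)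
      fix t
      have "Im z ^ n \<le> cmod (of_real t - z) ^ n"
        using z Im_le_cmod_shift by (intro power_mono) auto
      then show "norm (1 / (of_real t - z) ^ n) \<le> 1 / Im z ^ n"
        using z by (simp add: norm_divide norm_power frac_le)
    qed
  qed measurable
qed

text \<open>
  Differentiation under the integral sign: the remainder of the difference quotient has kernel
  \<open>(w - z) / ((t - w)(t - z)\<^sup>2)\<close>, which is \<open>O(|w - z|)\<close> uniformly in \<open>t\<close>.
\<close>

lemma cauchy_transform_holomorphic:
  assumes s: "sets M = sets borel" and fin: "finite_measure M"
  shows "(\<lambda>z. LINT t|M. 1 / (complex_of_real t - z)) holomorphic_on {z. 0 < Im z}"
proof -
  interpret finite_measure M by fact
  define C where "C z = (LINT t|M. 1 / (complex_of_real t - z))" for z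
  have "(C has_field_derivative (LINT t|M. 1 / (of_real t - z)\<^sup>2)) (at z)" if z: "0 < Im z" for z :: complex
  proof -
    define D where "D = (LINT t|M. 1 / (of_real t - z)\<^sup>2)"
    define L where "L = measure M (space M) * (2 / Im z ^ 3)"
    have i1: "integrable M (\<lambda>t. 1 / (of_real t - w))" if "0 < Im w" for w
      using cauchy_kernel_integrable[OF s fin that, of 1] by simp
    note i2 = cauchy_kernel_integrable[OF s fin z, of 2]
    have bound: "cmod ((C w - C z) / (w - z) - D) \<le> L * cmod (w - z)"
      if w: "w \<noteq> z" "cmod (w - z) < Im z / 2" for w
    proof -
      have "\<bar>Im w - Im z\<bar> < Im z / 2" using abs_Im_le_cmod[of "w - z"] w by simp
      then have Imw: "Im z / 2 < Im w" by linarith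
      then have w0: "0 < Im w" using z by linarith
      have "(C w - C z) / (w - z) - D
          = (LINT t|M. (1 / (of_real t - w) - 1 / (of_real t - z)) / (w - z) - 1 / (of_real t - z)\<^sup>2)"
        unfolding C_def D_def using i1[OF w0] i1[OF z] i2 by simp
      also have "\<dots> = (LINT t|M. (w - z) / ((of_real t - w) * (of_real t - z)\<^sup>2))"
      proof (rule Bochner_Integration.integral_cong[OF refl])
        fix t
        have "of_real t - w \<noteq> 0" "of_real t - z \<noteq> 0"
          using w0 z by (auto simp: complex_eq_iff)
        then show "(1 / (of_real t - w) - 1 / (of_real t - z)) / (w - z) - 1 / (of_real t - z)\<^sup>2
            = (w - z) / ((of_real t - w) * (of_real t - z)\<^sup>2)"
          using w(1) by (simp add: divide_simps) (simp add: algebra_simps power2_eq_square)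
      qed
      also have "cmod \<dots> \<le> measure M (space M) * (cmod (w - z) * (2 / Im z ^ 3))"
      proof -
        have ptw: "cmod ((w - z) / ((of_real t - w) * (of_real t - z)\<^sup>2)) \<le> cmod (w - z) * (2 / Im z ^ 3)" for t
        proof -
          have "(Im z / 2) * (Im z)\<^sup>2 \<le> cmod (of_real t - w) * cmod (of_real t - z) ^ 2"
            using Imw z Im_le_cmod_shift[of w t] Im_le_cmod_shift[of z t]
            by (intro mult_mono power_mono) auto
          then have "cmod (w - z) / (cmod (of_real t - w) * cmod (of_real t - z) ^ 2)
              \<le> cmod (w - z) / ((Im z / 2) * (Im z)\<^sup>2)"
            using z by (intro divide_left_mono) (auto intro!: mult_pos_pos zero_less_power
                less_le_trans[OF _ Im_le_cmod_shift] w0)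
          also have "\<dots> = cmod (w - z) * (2 / Im z ^ 3)"
            using z by (simp add: field_simps power2_eq_square power3_eq_cube)
          finally show ?thesis by (simp add: norm_divide norm_mult norm_power)
        qed
        have "cmod (LINT t|M. (w - z) / ((of_real t - w) * (of_real t - z)\<^sup>2))
            \<le> (LINT t|M. cmod ((w - z) / ((of_real t - w) * (of_real t - z)\<^sup>2)))"
          by (rule integral_norm_bound)
        also have "\<dots> \<le> (LINT t|M. cmod (w - z) * (2 / Im z ^ 3))"
          using ptw z by (intro integral_mono') auto
        finally show ?thesis by (simp only: lebesgue_integral_const real_scaleR_def)
      qed
      finally show ?thesis by (simp add: L_def mult_ac)
    qed
    have ev: "\<forall>\<^sub>F w in at z. w \<noteq> z \<and> cmod (w - z) < Im z / 2"
      unfolding eventually_at using z by (intro exI[of _ "Im z / 2"]) (auto simp: dist_norm)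
    have "((\<lambda>w. L * cmod (w - z)) \<longlongrightarrow> L * cmod (z - z)) (at z)" by (intro tendsto_intros)
    then have "((\<lambda>w. L * cmod (w - z)) \<longlongrightarrow> 0) (at z)" by simp
    then have "((\<lambda>w. (C w - C z) / (w - z) - D) \<longlongrightarrow> 0) (at z)"
      by (rule Lim_null_comparison[rotated]) (use ev in \<open>eventually_elim, use bound in blast\<close>)
    then show ?thesis unfolding has_field_derivative_iff D_def[symmetric] by (simp add: LIM_zero_iff)
  qed
  then have "C holomorphic_on {z. 0 < Im z}"
    by (auto simp: holomorphic_on_open open_halfspace_Im_gt)
  then show ?thesis by (simp add: C_def[abs_def])
qed

lemma Im_cauchy_transform:
  assumes s: "sets M = sets borel" and fin: "finite_measure M" and z: "0 < Im z"
  shows "ennreal (Im (LINT t|M. 1 / (of_real t - z)))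
    = (\<integral>\<^sup>+t. ennreal (Im z / ((t - Re z)\<^sup>2 + (Im z)\<^sup>2)) \<partial>M)"
proof -
  have i: "integrable M (\<lambda>t. 1 / (of_real t - z))"
    using cauchy_kernel_integrable[OF s fin z, of 1] by simp
  show ?thesis
    using integrable_Im[OF i] integral_Im[OF i] z unfolding Im_inverse_shift
    by (subst nn_integral_eq_integral) auto
qed

lemma Im_cauchy_transform_nonneg:
  assumes s: "sets M = sets borel" and fin: "finite_measure M" and z: "0 < Im z"
  shows "0 \<le> Im (LINT t|M. 1 / (of_real t - z))"
proof -
  have i: "integrable M (\<lambda>t. 1 / (of_real t - z))"
    using cauchy_kernel_integrable[OF s fin z, of 1] by simp
  show ?thesis
    using z unfolding integral_Im[OF i, symmetric] Im_inverse_shift by (intro integral_nonneg_AE) auto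
qed

lemma Im_cauchy_transform_vanishes_off_support:
  assumes s: "sets M = sets borel" and fin: "finite_measure M"
    and K: "closed K" "AE u in M. u \<in> K" and t: "t \<notin> K"
  shows "((\<lambda>y. Im (LINT u|M. 1 / (of_real u - Complex t y))) \<longlongrightarrow> 0) (at_right 0)"
proof -
  interpret finite_measure M by fact
  obtain d where d: "0 < d" "\<And>u. u \<in> K \<Longrightarrow> d \<le> \<bar>u - t\<bar>"
    using separate_point_closed[OF K(1) t] by (auto simp: dist_real_def abs_minus_commute)
  define m where "m = measure M (space M)"
  have le: "Im (LINT u|M. 1 / (of_real u - Complex t y)) \<le> y / d\<^sup>2 * m" if y: "0 < y" for y
  proof -
    have "ennreal (Im (LINT u|M. 1 / (of_real u - Complex t y)))
        = (\<integral>\<^sup>+u. ennreal (y / ((u - t)\<^sup>2 + y\<^sup>2)) \<partial>M)"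
      using Im_cauchy_transform[OF s fin, of "Complex t y"] y by simp
    also have "\<dots> \<le> (\<integral>\<^sup>+u. ennreal (y / d\<^sup>2) \<partial>M)"
      using K(2)
    proof (intro nn_integral_mono_AE, eventually_elim)
      fix u assume "u \<in> K"
      then have "\<bar>d\<bar> \<le> \<bar>u - t\<bar>" using d by simp
      then have "d\<^sup>2 \<le> (u - t)\<^sup>2 + y\<^sup>2" by (simp add: abs_le_square_iff add_increasing2)
      then show "ennreal (y / ((u - t)\<^sup>2 + y\<^sup>2)) \<le> ennreal (y / d\<^sup>2)"
        using y d(1) by (intro ennreal_leI divide_left_mono) (auto simp: add_nonneg_pos)
    qed
    also have "\<dots> = ennreal (y / d\<^sup>2 * m)"
      using y by (simp add: emeasure_eq_measure m_def ennreal_mult[symmetric])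
    finally show ?thesis using y by (simp add: m_def)
  qed
  have "((\<lambda>y. y / d\<^sup>2 * m) \<longlongrightarrow> 0 / d\<^sup>2 * m) (at_right 0)"
    using d(1) by (intro tendsto_intros) auto
  then have lim: "((\<lambda>y. y / d\<^sup>2 * m) \<longlongrightarrow> 0) (at_right 0)" by simp
  have pos: "\<forall>\<^sub>F y in at_right 0. (0::real) < y" by (rule eventually_at_right_less)
  show ?thesis
  proof (rule tendsto_sandwich[OF _ _ tendsto_const lim])
    show "\<forall>\<^sub>F y in at_right 0. 0 \<le> Im (LINT u|M. 1 / (of_real u - Complex t y))"
      using pos by eventually_elim (intro Im_cauchy_transform_nonneg s fin, simp)
    show "\<forall>\<^sub>F y in at_right 0. Im (LINT u|M. 1 / (of_real u - Complex t y)) \<le> y / d\<^sup>2 * m"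
      using pos by eventually_elim (rule le)
  qed
qed

lemma herglotz_measure_restrict:
  assumes "herglotz_measure \<mu>" and A: "A \<in> sets borel"
  shows "herglotz_measure (density \<mu> (indicator A))"
proof -
  have s[measurable_cong]: "sets \<mu> = sets borel" and fin: "(\<integral>\<^sup>+ t. ennreal (1 / (t\<^sup>2 + 1)) \<partial>\<mu>) < \<infinity>"
    using assms by (auto simp: herglotz_measure_def)
  note A[measurable]
  have "(\<integral>\<^sup>+ t. ennreal (1 / (t\<^sup>2 + 1)) \<partial>density \<mu> (indicator A))
      = (\<integral>\<^sup>+ t. indicator A t * ennreal (1 / (t\<^sup>2 + 1)) \<partial>\<mu>)"
    by (intro nn_integral_density) measurable
  also have "\<dots> \<le> (\<integral>\<^sup>+ t. ennreal (1 / (t\<^sup>2 + 1)) \<partial>\<mu>)"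
    by (intro nn_integral_mono) (auto simp: indicator_def)
  finally show ?thesis using fin s by (simp add: herglotz_measure_def)
qed

text \<open>
  Inner regularity for finite measures is applied to \<open>\<mu>\<close> with the density
  \<open>1 / (t\<^sup>2 + 1)\<close>, which is finite and has the same null sets as \<open>\<mu>\<close>.
\<close>

lemma compact_subset_positive_measure:
  assumes \<mu>: "herglotz_measure \<mu>" and B: "B \<in> sets borel" "emeasure \<mu> B \<noteq> 0"
  obtains K where "compact K" "K \<subseteq> B" "emeasure \<mu> K \<noteq> 0"
proof -
  have s[measurable_cong]: "sets \<mu> = sets borel" and fin: "(\<integral>\<^sup>+ t. ennreal (1 / (t\<^sup>2 + 1)) \<partial>\<mu>) < \<infinity>"
    using \<mu> by (auto simp: herglotz_measure_def)
  define w where "w t = ennreal (1 / (t\<^sup>2 + 1))" for t :: real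
  have [measurable]: "w \<in> borel_measurable borel" unfolding w_def by measurable
  have wpos: "w t \<noteq> 0" for t unfolding w_def ennreal_eq_0_iff not_le by (simp add: add_nonneg_pos)
  define P where "P = density \<mu> w"
  have sP: "sets P = sets borel" by (simp add: P_def s)
  have zero: "emeasure P A = 0 \<longleftrightarrow> emeasure \<mu> A = 0" if A[measurable]: "A \<in> sets borel" for A
  proof -
    have "emeasure P A = (\<integral>\<^sup>+ t. w t * indicator A t \<partial>\<mu>)"
      unfolding P_def using A s by (intro emeasure_density) auto
    then have "emeasure P A = 0 \<longleftrightarrow> (AE t in \<mu>. w t * indicator A t = 0)"
      by (simp add: nn_integral_0_iff_AE)
    also have "\<dots> \<longleftrightarrow> (AE t in \<mu>. t \<notin> A)"
      using wpos by (intro AE_cong) (auto simp: indicator_def)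
    also have "\<dots> \<longleftrightarrow> emeasure \<mu> A = 0"
      using A s sets.sets_into_space[of A \<mu>] by (intro AE_iff_measurable) auto
    finally show ?thesis .
  qed
  have "emeasure P (space P) = (\<integral>\<^sup>+ t. w t * indicator (space \<mu>) t \<partial>\<mu>)"
    unfolding P_def space_density by (intro emeasure_density) auto
  also have "\<dots> = (\<integral>\<^sup>+ t. w t \<partial>\<mu>)" by (intro nn_integral_cong) simp
  finally have "emeasure P (space P) \<noteq> \<infinity>" using fin by (simp add: w_def less_top)
  then have "emeasure P B = (SUP K\<in>{K. K \<subseteq> B \<and> compact K}. emeasure P K)"
    using inner_regular[OF sP _ B(1)] by simp
  moreover have "emeasure P B \<noteq> 0" using B zero by simp
  ultimately have "\<exists>K. K \<subseteq> B \<and> compact K \<and> emeasure P K \<noteq> 0"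
    by (metis (mono_tags, lifting) SUP_least le_zero_eq mem_Collect_eq)
  then obtain K where "K \<subseteq> B" "compact K" "emeasure P K \<noteq> 0" by blast
  then show thesis using that zero[of K] by (auto simp: borel_compact)
qed

lemma nn_integral_split_restrict:
  assumes A: "A \<in> sets M" and f: "f \<in> borel_measurable M"
  shows "(\<integral>\<^sup>+ t. f t \<partial>M)
    = (\<integral>\<^sup>+ t. f t \<partial>density M (indicator A)) + (\<integral>\<^sup>+ t. f t \<partial>density M (indicator (- A)))"
proof -
  have cA: "(indicator (- A) :: _ \<Rightarrow> ennreal) \<in> borel_measurable M"
  proof -
    have "(indicator (space M - A) :: _ \<Rightarrow> ennreal) \<in> borel_measurable M" using A by measurable
    then show ?thesis by (rule measurable_cong[THEN iffD1, rotated]) (auto simp: indicator_def)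
  qed
  have "(\<integral>\<^sup>+ t. f t \<partial>M) = (\<integral>\<^sup>+ t. indicator A t * f t + indicator (- A) t * f t \<partial>M)"
    by (intro nn_integral_cong) (auto simp: indicator_def)
  also have "\<dots> = (\<integral>\<^sup>+ t. indicator A t * f t \<partial>M) + (\<integral>\<^sup>+ t. indicator (- A) t * f t \<partial>M)"
    using A f cA by (intro nn_integral_add) auto
  finally show ?thesis using A f cA by (simp add: nn_integral_density)
qed

section \<open>Poisson integrals near a point of relative density zero\<close>

lemma poisson_kernel_level_set:
  fixes x y \<tau> :: real
  assumes \<tau>: "0 < \<tau>" and y: "0 < y"
  shows "\<exists>u. {t. \<tau> < 1 / ((t - x)\<^sup>2 + y\<^sup>2)} = {x - u<..<x + u}"
proof -
  define u where "u = sqrt (max 0 (1 / \<tau> - y\<^sup>2))"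
  have "\<tau> < 1 / ((t - x)\<^sup>2 + y\<^sup>2) \<longleftrightarrow> t \<in> {x - u<..<x + u}" for t
  proof -
    have "0 < (t - x)\<^sup>2 + y\<^sup>2" using y by (simp add: add_nonneg_pos)
    then have "\<tau> < 1 / ((t - x)\<^sup>2 + y\<^sup>2) \<longleftrightarrow> (t - x)\<^sup>2 < 1 / \<tau> - y\<^sup>2"
      using \<tau> by (auto simp: field_simps)
    also have "\<dots> \<longleftrightarrow> (t - x)\<^sup>2 < max 0 (1 / \<tau> - y\<^sup>2)"
      using zero_le_power2[of "t - x"] by linarith
    also have "\<dots> \<longleftrightarrow> sqrt ((t - x)\<^sup>2) < u" unfolding u_def by (rule real_sqrt_less_iff[symmetric])
    also have "\<dots> \<longleftrightarrow> t \<in> {x - u<..<x + u}" by (auto simp: abs_less_iff)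
    finally show ?thesis .
  qed
  then show ?thesis by (intro exI[of _ u]) blast
qed

text \<open>
  The interval bound on \<open>A\<close> controls the part of the kernel near \<open>x\<close>, through its level sets.
  The part of the integral away from \<open>x\<close> and the constant \<open>b\<close> stay bounded as \<open>y \<rightarrow> 0\<close>; they are
  absorbed because domination of Lebesgue measure by \<open>M\<close> makes the integral over \<open>M\<close> unbounded.
\<close>

lemma poisson_integral_negligible:
  fixes A M :: "real measure" and x b c :: real
  assumes s: "sets A = sets borel" "sets M = sets borel"
    and sf: "sigma_finite_measure A" and fin: "finite_measure M"
    and tail: "(\<integral>\<^sup>+t. ennreal (1 / (t\<^sup>2 + 1)) \<partial>A) < \<infinity>"
    and A: "\<And>c. 0 < c \<Longrightarrow> \<forall>\<^sub>F r in at_right 0.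
      emeasure A {x - r<..<x + r} \<le> ennreal c * emeasure M {x - r<..<x + r}"
    and L: "\<And>c. 0 < c \<Longrightarrow> \<forall>\<^sub>F r in at_right 0.
      emeasure lborel {x - r<..<x + r} \<le> ennreal c * emeasure M {x - r<..<x + r}"
    and b: "0 \<le> b" and c: "0 < c"
  shows "\<forall>\<^sub>F y in at_right 0.
    ennreal b + (\<integral>\<^sup>+t. ennreal (1 / ((t - x)\<^sup>2 + y\<^sup>2)) \<partial>A)
      \<le> ennreal c * (\<integral>\<^sup>+t. ennreal (1 / ((t - x)\<^sup>2 + y\<^sup>2)) \<partial>M)"
proof -
  interpret M: finite_measure M by fact
  note s[measurable_cong]
  define k where "k y t = 1 / ((t - x)\<^sup>2 + y\<^sup>2)" for y t :: real
  have k_meas [measurable]: "k y \<in> borel_measurable borel" for y unfolding k_def by measurable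
  have k0: "0 \<le> k y t" for y t by (simp add: k_def add_nonneg_nonneg)
  obtain r0 where r0: "0 < r0" "\<And>r. 0 < r \<Longrightarrow> r < r0 \<Longrightarrow>
      emeasure A {x - r<..<x + r} \<le> ennreal (c / 2) * emeasure M {x - r<..<x + r}"
    using A[of "c / 2"] c unfolding eventually_at_right_field by auto
  define r1 where "r1 = r0 / 2"
  have r1: "0 < r1" "r1 < r0" using r0(1) by (auto simp: r1_def)
  let ?I = "{x - r1<..<x + r1}"
  \<comment> \<open>On intervals of radius at most \<open>r1\<close> the measure \<open>A\<close> is bounded by \<open>B\<close>.\<close>
  define B where "B = scale_measure (ennreal (c / 2)) M"
  have sB: "sets B = sets borel" by (simp add: B_def s)
  have "finite_measure B"
    by (rule finite_measureI) (auto simp: B_def ennreal_mult_eq_top_iff M.emeasure_finite)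
  then have sfB: "sigma_finite_measure B"
    by (simp add: finite_measure_def)
  have near: "(\<integral>\<^sup>+t. ennreal (k y t) * indicator ?I t \<partial>A) \<le> ennreal (c / 2) * (\<integral>\<^sup>+t. ennreal (k y t) \<partial>M)"
    if y: "0 < y" for y
  proof -
    have "(\<integral>\<^sup>+t. ennreal (k y t) * indicator ?I t \<partial>A) \<le> (\<integral>\<^sup>+t. ennreal (k y t) * indicator ?I t \<partial>B)"
    proof (rule nn_integral_mono_centered_intervals[OF sf sfB s(1) sB k_meas k0])
      show "\<exists>u. {t. \<tau> < k y t} = {x - u<..<x + u}" if "0 < \<tau>" for \<tau>
        unfolding k_def by (rule poisson_kernel_level_set[OF that y])
      show "emeasure A {x - r<..<x + r} \<le> emeasure B {x - r<..<x + r}" if "0 < r" "r \<le> r1" for r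
        using r0(2)[of r] that r1 by (simp add: B_def)
    qed
    also have "\<dots> \<le> (\<integral>\<^sup>+t. ennreal (k y t) \<partial>B)"
      by (intro nn_integral_mono) (auto simp: indicator_def)
    also have "\<dots> = ennreal (c / 2) * (\<integral>\<^sup>+t. ennreal (k y t) \<partial>M)"
      unfolding B_def by (rule nn_integral_scale_measure) measurable
    finally show ?thesis .
  qed
  \<comment> \<open>Chosen so that \<open>t\<^sup>2 + 1 \<le> C (t - x)\<^sup>2\<close> whenever \<open>|t - x| \<ge> r1\<close>.\<close>
  define C where "C = 2 + (2 * x\<^sup>2 + 1) / r1\<^sup>2"
  have C0: "0 \<le> C" by (simp add: C_def add_nonneg_nonneg)
  define D where "D = ennreal b + ennreal C * (\<integral>\<^sup>+t. ennreal (1 / (t\<^sup>2 + 1)) \<partial>A)"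
  have far: "(\<integral>\<^sup>+t. ennreal (k y t) * indicator (- ?I) t \<partial>A) \<le> ennreal C * (\<integral>\<^sup>+t. ennreal (1 / (t\<^sup>2 + 1)) \<partial>A)"
    for y
  proof -
    have "(\<integral>\<^sup>+t. ennreal (k y t) * indicator (- ?I) t \<partial>A) \<le> (\<integral>\<^sup>+t. ennreal C * ennreal (1 / (t\<^sup>2 + 1)) \<partial>A)"
    proof (rule nn_integral_mono)
      fix t
      show "ennreal (k y t) * indicator (- ?I) t \<le> ennreal C * ennreal (1 / (t\<^sup>2 + 1))"
      proof (cases "t \<in> ?I")
        case False
        define p where "p = (t - x)\<^sup>2"
        have "\<bar>r1\<bar> \<le> \<bar>t - x\<bar>" using False r1 by auto
        then have p: "r1\<^sup>2 \<le> p" unfolding p_def by (simp only: abs_le_square_iff)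
        have r12: "0 < r1\<^sup>2" using r1 by simp
        \<comment> \<open>This is \<open>(t - 2x)\<^sup>2 \<ge> 0\<close>.\<close>
        have "t\<^sup>2 \<le> 2 * p + 2 * x\<^sup>2"
          using zero_le_power2[of "t - 2 * x"] unfolding p_def by (simp add: power2_eq_square algebra_simps)
        moreover have "2 * x\<^sup>2 + 1 \<le> (2 * x\<^sup>2 + 1) / r1\<^sup>2 * p"
        proof -
          have "(2 * x\<^sup>2 + 1) / r1\<^sup>2 * r1\<^sup>2 \<le> (2 * x\<^sup>2 + 1) / r1\<^sup>2 * p"
            using p by (intro mult_left_mono) (auto simp: add_nonneg_nonneg)
          then show ?thesis using r12 by simp
        qed
        ultimately have "t\<^sup>2 + 1 \<le> C * p" by (simp add: C_def distrib_right)
        also have "\<dots> \<le> C * (p + y\<^sup>2)" using C0 by (intro mult_left_mono) auto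
        finally have "t\<^sup>2 + 1 \<le> C * (p + y\<^sup>2)" .
        moreover have "0 < p + y\<^sup>2" using less_le_trans[OF r12 p] by (simp add: add_pos_nonneg)
        moreover have "0 < t\<^sup>2 + 1" by (simp add: add_nonneg_pos)
        ultimately have "k y t \<le> C * (1 / (t\<^sup>2 + 1))"
          unfolding k_def p_def by (simp add: divide_simps mult.commute)
        then have "ennreal (k y t) \<le> ennreal (C * (1 / (t\<^sup>2 + 1)))" by (rule ennreal_leI)
        then show ?thesis using False C0
          by (subst (asm) ennreal_mult) (auto simp: add_nonneg_nonneg)
      qed simp
    qed
    also have "\<dots> = ennreal C * (\<integral>\<^sup>+t. ennreal (1 / (t\<^sup>2 + 1)) \<partial>A)"
      by (rule nn_integral_cmult) measurable
    finally show ?thesis .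
  qed
  have "D < \<infinity>" using tail by (simp add: D_def ennreal_mult_less_top)
  then obtain d where d: "D = ennreal d" "0 \<le> d" by (cases D rule: ennreal_cases) auto
  define c' where "c' = c / (2 * (d + 1))"
  have c': "0 < c'" using c d(2) by (simp add: c'_def)
  have "\<forall>\<^sub>F y in at_right 0. y \<in> {0<..<1::real}" by (rule eventually_at_right_real) simp
  with L[OF c'] show ?thesis
  proof eventually_elim
    fix y assume Ly: "emeasure lborel {x - y<..<x + y} \<le> ennreal c' * emeasure M {x - y<..<x + y}"
      and y: "y \<in> {0<..<1::real}"
    let ?J = "{x - y<..<x + y}"
    have "ennreal (1 / y) = ennreal (1 / (2 * y\<^sup>2)) * ennreal (2 * y)"
      using y by (simp add: ennreal_mult[symmetric] power2_eq_square)
    also have "\<dots> \<le> ennreal (1 / (2 * y\<^sup>2)) * (ennreal c' * emeasure M ?J)"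
      using Ly y by (intro mult_left_mono) auto
    also have "\<dots> = ennreal c' * (ennreal (1 / (2 * y\<^sup>2)) * emeasure M ?J)"
      by (simp add: mult_ac)
    also have "\<dots> = ennreal c' * (\<integral>\<^sup>+t. ennreal (1 / (2 * y\<^sup>2)) * indicator ?J t \<partial>M)"
      by (subst nn_integral_cmult_indicator) (simp_all add: s)
    also have "\<dots> \<le> ennreal c' * (\<integral>\<^sup>+t. ennreal (k y t) \<partial>M)"
    proof (intro mult_left_mono nn_integral_mono)
      fix t
      show "ennreal (1 / (2 * y\<^sup>2)) * indicator ?J t \<le> ennreal (k y t)"
      proof (cases "t \<in> ?J")
        case True
        then have "\<bar>t - x\<bar> \<le> \<bar>y\<bar>" by auto
        then have "(t - x)\<^sup>2 \<le> y\<^sup>2" by (simp only: abs_le_square_iff)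
        moreover have "0 < (t - x)\<^sup>2 + y\<^sup>2" using y by (simp add: add_nonneg_pos)
        ultimately have "1 / (2 * y\<^sup>2) \<le> k y t" unfolding k_def using y by (intro frac_le) auto
        then show ?thesis using True by (simp add: ennreal_leI)
      qed simp
    qed simp
    finally have one: "ennreal (1 / y) \<le> ennreal c' * (\<integral>\<^sup>+t. ennreal (k y t) \<partial>M)" .
    \<comment> \<open>The choice of \<open>c'\<close> turns the fixed quantity \<open>D\<close> into half of the allowed bound.\<close>
    have "D \<le> ennreal (d + 1) * ennreal (1 / y)"
    proof -
      have "d \<le> d * (1 / y)" using d(2) y by (simp add: le_divide_eq mult_left_le)
      also have "\<dots> \<le> (d + 1) * (1 / y)" using y by (intro mult_right_mono) auto
      finally show ?thesis using d y by (simp add: ennreal_mult[symmetric] ennreal_leI del: ennreal_plus)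
    qed
    also have "\<dots> \<le> ennreal (d + 1) * (ennreal c' * (\<integral>\<^sup>+t. ennreal (k y t) \<partial>M))"
      using one by (rule mult_left_mono) simp
    also have "\<dots> = ennreal (c / 2) * (\<integral>\<^sup>+t. ennreal (k y t) \<partial>M)"
    proof -
      have "(d + 1) * c' = c / 2" using d(2) by (simp add: c'_def field_simps)
      then have "ennreal (d + 1) * ennreal c' = ennreal (c / 2)"
        using d(2) c' by (subst ennreal_mult[symmetric]) auto
      then show ?thesis by (simp only: mult.assoc[symmetric])
    qed
    finally have Dle: "D \<le> ennreal (c / 2) * (\<integral>\<^sup>+t. ennreal (k y t) \<partial>M)" .
    have "(\<integral>\<^sup>+t. ennreal (k y t) \<partial>A)
        = (\<integral>\<^sup>+t. ennreal (k y t) * indicator ?I t + ennreal (k y t) * indicator (- ?I) t \<partial>A)"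
      by (intro nn_integral_cong) (auto simp: indicator_def)
    also have "\<dots> = (\<integral>\<^sup>+t. ennreal (k y t) * indicator ?I t \<partial>A) + (\<integral>\<^sup>+t. ennreal (k y t) * indicator (- ?I) t \<partial>A)"
      by (rule nn_integral_add) measurable
    finally have "ennreal b + (\<integral>\<^sup>+t. ennreal (k y t) \<partial>A)
        = (\<integral>\<^sup>+t. ennreal (k y t) * indicator ?I t \<partial>A) + (ennreal b + (\<integral>\<^sup>+t. ennreal (k y t) * indicator (- ?I) t \<partial>A))"
      by (simp add: ac_simps)
    also have "\<dots> \<le> ennreal (c / 2) * (\<integral>\<^sup>+t. ennreal (k y t) \<partial>M) + D"
      using y unfolding D_def by (intro add_mono near far order_refl) auto
    also have "\<dots> \<le> ennreal (c / 2) * (\<integral>\<^sup>+t. ennreal (k y t) \<partial>M) + ennreal (c / 2) * (\<integral>\<^sup>+t. ennreal (k y t) \<partial>M)"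
      using Dle by (rule add_left_mono)
    also have "\<dots> = ennreal c * (\<integral>\<^sup>+t. ennreal (k y t) \<partial>M)"
      using c by (simp add: distrib_right[symmetric] ennreal_plus[symmetric] del: ennreal_plus)
    finally show "ennreal b + (\<integral>\<^sup>+t. ennreal (1 / ((t - x)\<^sup>2 + y\<^sup>2)) \<partial>A)
      \<le> ennreal c * (\<integral>\<^sup>+t. ennreal (1 / ((t - x)\<^sup>2 + y\<^sup>2)) \<partial>M)"
      by (simp only: k_def)
  qed
qed

section \<open>Lebesgue density at points of domination\<close>

lemma Re_csqrt_ge:
  assumes "0 \<le> Re w"
  shows "sqrt (cmod w / 2) \<le> Re (csqrt w)"
  using assms by simp

text \<open>
  For purely imaginary \<open>w\<close> and \<open>v = 0\<close> this amounts to \<open>s + s\<^sup>-\<^sup>1\<^sup>/\<^sup>2 \<ge> 1\<close> with \<open>s = |w| / \<kappa>\<close>: the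
  first term is at least 1 if \<open>s \<ge> 1\<close>, and the second if \<open>s \<le> 1\<close>. The error \<open>\<eta>\<close> measures how far the
  values above the real line are from this ideal case.
\<close>

lemma comparison_value_ge:
  fixes w :: complex and v \<kappa> \<eta> :: real
  assumes w: "0 < Im w" "\<bar>Re w\<bar> \<le> \<eta>" and v: "v \<le> \<eta>" "v \<le> Im w" and \<kappa>: "0 < \<kappa>"
  shows "1 - 2 * \<eta> / \<kappa> \<le> (Im w - v) / \<kappa> + sqrt (2 * \<kappa>) * Re (csqrt (\<i> / w))"
proof -
  have w0: "0 < cmod w" using w(1) by auto
  have "0 \<le> Re (\<i> / w)" using w(1) by (simp add: Re_divide)
  then have "sqrt (2 * \<kappa>) * sqrt (cmod (\<i> / w) / 2) \<le> sqrt (2 * \<kappa>) * Re (csqrt (\<i> / w))"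
    using \<kappa> by (intro mult_left_mono Re_csqrt_ge) auto
  then have root: "sqrt (\<kappa> / cmod w) \<le> sqrt (2 * \<kappa>) * Re (csqrt (\<i> / w))"
    by (simp add: real_sqrt_mult[symmetric] norm_divide del: csqrt.sel)
  show ?thesis
  proof (cases "cmod w \<le> \<kappa>")
    case True
    then have "1 \<le> sqrt (\<kappa> / cmod w)" using w0 by simp
    moreover have "0 \<le> (Im w - v) / \<kappa>" "0 \<le> \<eta> / \<kappa>" using v \<kappa> w by auto
    ultimately show ?thesis using root by linarith
  next
    case False
    have "\<kappa> - 2 * \<eta> \<le> Im w - v" using cmod_le[of w] False w v by linarith
    then have "(\<kappa> - 2 * \<eta>) / \<kappa> \<le> (Im w - v) / \<kappa>" using \<kappa> by (intro divide_right_mono) auto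
    moreover have "(\<kappa> - 2 * \<eta>) / \<kappa> = 1 - 2 * \<eta> / \<kappa>" using \<kappa> by (simp add: diff_divide_distrib)
    moreover have "0 \<le> sqrt (\<kappa> / cmod w)" using \<kappa> w0 by simp
    ultimately show ?thesis using root by linarith
  qed
qed

text \<open>
  The role of \<open>F1\<close> is to carry almost all of \<open>Im F\<close> at the point \<open>x + ih\<close> while its imaginary
  part leaves no trace on the boundary over \<open>E\<close>. The proof applies
  \<open>lebesgue_measure_le_boundary_liminf\<close> to the comparison function \<open>Q\<close>; the parameter \<open>\<theta>\<close> is the
  threshold, relative to \<open>Im F(x + ih)\<close>, that separates small from large boundary values of \<open>F\<close>.
\<close>

lemma density_le_of_dominated_part:
  fixes F F1 :: "complex \<Rightarrow> complex"
  assumes F: "F holomorphic_on {z. 0 < Im z}" "\<And>z. 0 < Im z \<Longrightarrow> 0 < Im (F z)"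
    and F1: "F1 holomorphic_on {z. 0 < Im z}" "\<And>z. 0 < Im z \<Longrightarrow> Im (F1 z) \<le> Im (F z)"
    and E: "E \<in> sets borel"
    and bd: "AE t in lborel. t \<in> E \<longrightarrow>
      ((\<lambda>y. Re (F (Complex t y))) \<longlongrightarrow> 0) (at_right 0) \<and> ((\<lambda>y. Im (F1 (Complex t y))) \<longlongrightarrow> 0) (at_right 0)"
    and h: "0 < h" and dom: "Im (F (Complex x h)) - Im (F1 (Complex x h)) \<le> c * Im (F (Complex x h))"
    and \<theta>: "0 < \<theta>"
  shows "measure lborel (E \<inter> {x - h<..<x + h}) / (2 * h) \<le> pi * (c / \<theta> + sqrt (2 * \<theta>))"
proof -
  define m where "m = Im (F (Complex x h))"
  have m: "0 < m" unfolding m_def using h by (intro F) simp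
  define \<kappa> where "\<kappa> = \<theta> * m"
  have \<kappa>: "0 < \<kappa>" using \<theta> m by (simp add: \<kappa>_def)
  define Q where "Q z = - \<i> * (F z - F1 z) / of_real \<kappa> + of_real (sqrt (2 * \<kappa>)) * csqrt (\<i> / F z)" for z
  have ReQ: "Re (Q z) = (Im (F z) - Im (F1 z)) / \<kappa> + sqrt (2 * \<kappa>) * Re (csqrt (\<i> / F z))" for z
  proof -
    have "Re (- \<i> * w / of_real \<kappa>) = Im w / \<kappa>" for w by (simp add: Re_divide_of_real)
    moreover have "Re (of_real r * w) = r * Re w" for r w by simp
    ultimately show ?thesis
      unfolding Q_def by (simp only: plus_complex.sel minus_complex.sel)
  qed
  have nz: "F z \<noteq> 0" if "0 < Im z" for z using F(2)[OF that] by auto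
  have Re_pos: "0 < Re (\<i> / F z)" if "0 < Im z" for z
  proof -
    have "Re (\<i> / F z) = Im (F z) / (cmod (F z))\<^sup>2" unfolding cmod_power2 by (simp add: Re_divide)
    then show ?thesis using F(2)[OF that] nz[OF that] by simp
  qed
  have holo: "Q holomorphic_on {z. 0 < Im z}"
    unfolding Q_def using nz Re_pos \<kappa>
    by (intro holomorphic_intros F(1) F1(1)) (fastforce simp: complex_nonpos_Reals_iff)+
  have nonneg: "0 \<le> Re (Q z)" if "0 < Im z" for z
    unfolding ReQ using F1(2)[OF that] \<kappa> csqrt_principal[of "\<i> / F z"]
    by (intro add_nonneg_nonneg mult_nonneg_nonneg divide_nonneg_nonneg) (auto simp del: csqrt.sel)
  have "measure lborel (E \<inter> {x - h<..<x + h}) \<le> 2 * pi * h * Re (Q (Complex x h))"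
  proof (rule lebesgue_measure_le_boundary_liminf[OF holo nonneg h])
    show "AE t in lborel. t \<in> E \<inter> {x - h<..<x + h} \<longrightarrow> (\<forall>c<1. \<forall>\<^sub>F \<delta> in at_right 0. c \<le> Re (Q (Complex t \<delta>)))"
      using bd
    proof (eventually_elim, intro impI allI)
      fix t c :: real
      assume "t \<in> E \<longrightarrow> ((\<lambda>y. Re (F (Complex t y))) \<longlongrightarrow> 0) (at_right 0) \<and>
          ((\<lambda>y. Im (F1 (Complex t y))) \<longlongrightarrow> 0) (at_right 0)"
        and "t \<in> E \<inter> {x - h<..<x + h}" and c: "c < 1"
      then have lim: "((\<lambda>y. Re (F (Complex t y))) \<longlongrightarrow> 0) (at_right 0)"
          "((\<lambda>y. Im (F1 (Complex t y))) \<longlongrightarrow> 0) (at_right 0)"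
        by auto
      \<comment> \<open>With this \<open>\<eta>\<close> the bound of \<open>comparison_value_ge\<close> is exactly \<open>c\<close>.\<close>
      define \<eta> where "\<eta> = \<kappa> * (1 - c) / 2"
      have \<eta>: "0 < \<eta>" using \<kappa> c by (simp add: \<eta>_def)
      have "\<forall>\<^sub>F y in at_right 0. \<bar>Re (F (Complex t y))\<bar> < \<eta>"
        using tendstoD[OF lim(1) \<eta>] by (simp add: dist_real_def)
      moreover have "\<forall>\<^sub>F y in at_right 0. Im (F1 (Complex t y)) < \<eta>"
        using lim(2) \<eta> by (rule order_tendstoD)
      moreover have "\<forall>\<^sub>F y in at_right 0. (0::real) < y" by (rule eventually_at_right_less)
      ultimately show "\<forall>\<^sub>F y in at_right 0. c \<le> Re (Q (Complex t y))"
      proof eventually_elim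
        fix y :: real
        assume y: "\<bar>Re (F (Complex t y))\<bar> < \<eta>" "Im (F1 (Complex t y)) < \<eta>" "0 < y"
        have "1 - 2 * \<eta> / \<kappa> \<le> Re (Q (Complex t y))"
          unfolding ReQ using y F(2) F1(2) \<kappa> by (intro comparison_value_ge) auto
        moreover have "1 - 2 * \<eta> / \<kappa> = c" using \<kappa> by (simp add: \<eta>_def)
        ultimately show "c \<le> Re (Q (Complex t y))" by simp
      qed
    qed
  qed (use E in auto)
  also have "\<dots> \<le> 2 * pi * h * (c / \<theta> + sqrt (2 * \<theta>))"
  proof (rule mult_left_mono)
    let ?w = "F (Complex x h)"
    have "(Im ?w - Im (F1 (Complex x h))) / \<kappa> \<le> c * m / \<kappa>"
      using dom \<kappa> unfolding m_def by (intro divide_right_mono) auto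
    also have "\<dots> = c / \<theta>" using m by (simp add: \<kappa>_def)
    finally have first: "(Im ?w - Im (F1 (Complex x h))) / \<kappa> \<le> c / \<theta>" .
    have w: "m \<le> cmod ?w" unfolding m_def using abs_Im_le_cmod[of ?w] by linarith
    have "Re (csqrt (\<i> / ?w)) \<le> cmod (csqrt (\<i> / ?w))" by (rule complex_Re_le_cmod)
    also have "\<dots> = sqrt (1 / cmod ?w)"
      by (simp add: norm_csqrt norm_divide del: csqrt.sel)
    also have "\<dots> \<le> sqrt (1 / m)" using w m by (intro real_sqrt_le_mono divide_left_mono mult_pos_pos) auto
    finally have "sqrt (2 * \<kappa>) * Re (csqrt (\<i> / ?w)) \<le> sqrt (2 * \<kappa>) * sqrt (1 / m)"
      using \<kappa> by (intro mult_left_mono) auto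
    also have "\<dots> = sqrt (2 * \<theta>)" using m by (simp add: real_sqrt_mult[symmetric] \<kappa>_def)
    finally show "Re (Q (Complex x h)) \<le> c / \<theta> + sqrt (2 * \<theta>)"
      unfolding ReQ using first by linarith
  qed (use h in simp)
  finally show ?thesis using h by (simp add: field_simps)
qed

text \<open>
  The choice \<open>c = \<theta>\<^sup>2\<close> makes both terms of the preceding bound tend to zero with \<open>\<theta>\<close>.
\<close>

lemma density_zero_of_dominated_part:
  fixes F F1 :: "complex \<Rightarrow> complex"
  assumes F: "F holomorphic_on {z. 0 < Im z}" "\<And>z. 0 < Im z \<Longrightarrow> 0 < Im (F z)"
    and F1: "F1 holomorphic_on {z. 0 < Im z}" "\<And>z. 0 < Im z \<Longrightarrow> Im (F1 z) \<le> Im (F z)"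
    and E: "E \<in> sets borel"
    and bd: "AE t in lborel. t \<in> E \<longrightarrow>
      ((\<lambda>y. Re (F (Complex t y))) \<longlongrightarrow> 0) (at_right 0) \<and> ((\<lambda>y. Im (F1 (Complex t y))) \<longlongrightarrow> 0) (at_right 0)"
    and dom: "\<And>c. 0 < c \<Longrightarrow> \<forall>\<^sub>F y in at_right 0.
      Im (F (Complex x y)) - Im (F1 (Complex x y)) \<le> c * Im (F (Complex x y))"
  shows "((\<lambda>h. measure lborel (E \<inter> {x - h<..<x + h}) / (2 * h)) \<longlongrightarrow> 0) (at_right 0)"
proof (rule order_tendstoI)
  fix e :: real assume "e < 0"
  moreover have "\<forall>\<^sub>F h in at_right 0. (0::real) < h" by (rule eventually_at_right_less)
  ultimately show "\<forall>\<^sub>F h in at_right 0. e < measure lborel (E \<inter> {x - h<..<x + h}) / (2 * h)"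
    by (auto elim!: eventually_mono intro: less_le_trans)
next
  fix e :: real assume e: "0 < e"
  have "((\<lambda>\<theta>. pi * (\<theta>\<^sup>2 / \<theta> + sqrt (2 * \<theta>))) \<longlongrightarrow> pi * (0 + sqrt (2 * 0))) (at_right 0)"
  proof (intro tendsto_intros)
    have "\<forall>\<^sub>F \<theta> in at_right 0. (0::real) < \<theta>" by (rule eventually_at_right_less)
    then have "\<forall>\<^sub>F \<theta> in at_right 0. \<theta> = \<theta>\<^sup>2 / (\<theta>::real)"
      by eventually_elim (simp add: power2_eq_square)
    then show "((\<lambda>\<theta>. \<theta>\<^sup>2 / \<theta>) \<longlongrightarrow> (0::real)) (at_right 0)"
      by (rule Lim_transform_eventually[rotated]) (rule tendsto_ident_at)
  qed
  then have "((\<lambda>\<theta>. pi * (\<theta>\<^sup>2 / \<theta> + sqrt (2 * \<theta>))) \<longlongrightarrow> 0) (at_right 0)" by simp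
  then have "\<forall>\<^sub>F \<theta> in at_right 0. pi * (\<theta>\<^sup>2 / \<theta> + sqrt (2 * \<theta>)) < e"
    using e by (rule order_tendstoD)
  moreover have "\<forall>\<^sub>F \<theta> in at_right 0. (0::real) < \<theta>" by (rule eventually_at_right_less)
  ultimately have "\<forall>\<^sub>F \<theta> in at_right 0. 0 < \<theta> \<and> pi * (\<theta>\<^sup>2 / \<theta> + sqrt (2 * \<theta>)) < e"
    by eventually_elim simp
  then obtain \<theta> :: real where \<theta>: "0 < \<theta>" "pi * (\<theta>\<^sup>2 / \<theta> + sqrt (2 * \<theta>)) < e"
    using eventually_happens'[OF trivial_limit_at_right_real] by blast
  have "\<forall>\<^sub>F h in at_right 0. Im (F (Complex x h)) - Im (F1 (Complex x h)) \<le> \<theta>\<^sup>2 * Im (F (Complex x h))"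
    using \<theta>(1) by (intro dom) simp
  moreover have "\<forall>\<^sub>F h in at_right 0. (0::real) < h" by (rule eventually_at_right_less)
  ultimately show "\<forall>\<^sub>F h in at_right 0. measure lborel (E \<inter> {x - h<..<x + h}) / (2 * h) < e"
  proof eventually_elim
    case (elim h)
    show ?case
      using density_le_of_dominated_part[OF F F1 E bd elim(2,1) \<theta>(1)] \<theta>(2) by (rule le_less_trans)
  qed
qed

text \<open>
  The Cauchy transform of the restriction of \<open>\<mu>\<close> to \<open>K\<close> is the dominating part required by
  \<open>density_zero_of_dominated_part\<close>: its imaginary part vanishes on the boundary off the Lebesgue null
  set \<open>K\<close>. Lebesgue measure and the rest of \<open>\<mu>\<close> both give \<open>K\<close> measure zero, so the differentiation
  theorem applies to each of them.
\<close>

lemma reflectionless_density_zero: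
  fixes E K :: "real set"
  assumes \<mu>: "herglotz_measure \<mu>" and b: "0 \<le> b"
    and F: "herglotz_rep a b \<mu> \<in> reflectionless_herglotz E" and E: "E \<in> sets borel"
    and K: "compact K" "K \<in> null_sets lborel"
  shows "AE x in density \<mu> (indicator K). x \<in> K \<and>
    ((\<lambda>h. measure lborel (E \<inter> {x - h<..<x + h}) / (2 * h)) \<longlongrightarrow> 0) (at_right 0)"
proof -
  define M where "M = density \<mu> (indicator K)"
  define R where "R = density \<mu> (indicator (- K))"
  have s: "sets \<mu> = sets borel" using \<mu> by (simp add: herglotz_measure_def)
  have Kb: "K \<in> sets borel" "- K \<in> sets borel" using K(1) by (auto intro: borel_compact borel_comp)
  have sM: "sets M = sets borel" and sR: "sets R = sets borel" by (simp_all add: M_def R_def s)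
  have R: "herglotz_measure R" unfolding R_def using \<mu> Kb(2) by (rule herglotz_measure_restrict)
  have M_space: "emeasure M (space M) = emeasure \<mu> K"
    using Kb s sets_eq_imp_space_eq[OF s] by (simp add: M_def emeasure_restricted)
  obtain c where "\<And>t. t \<in> K \<Longrightarrow> \<bar>t\<bar> \<le> c" 
    using compact_imp_bounded[OF K(1)] by (auto simp: bounded_iff)
  then have "K \<subseteq> {- c..c}" by (auto simp: abs_le_iff minus_le_iff)
  then have "emeasure \<mu> K \<le> emeasure \<mu> {- c..c}" using s by (intro emeasure_mono) auto
  then have finM: "emeasure M (space M) \<noteq> \<infinity>"
    using herglotz_measure_Icc_finite[OF \<mu>, of "- c" c] M_space by (auto simp: less_top top_unique)
  then have fmM: "finite_measure M" by (rule finite_measureI)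
  have "emeasure R K = emeasure \<mu> (- K \<inter> K)"
    unfolding R_def using Kb s by (intro emeasure_restricted) auto
  then have RK: "emeasure R K = 0" by simp
  have LK: "emeasure lborel K = 0" using K(2) by auto
  have inK: "AE x in M. x \<in> K"
    unfolding M_def using Kb s by (subst AE_density) (auto simp: indicator_def)
  have notK: "AE t in lborel. t \<notin> K" using K(2) by (rule AE_not_in)
  define F0 where "F0 = herglotz_rep a b \<mu>"
  define F1 where "F1 z = (LINT t|M. 1 / (complex_of_real t - z))" for z
  have F0: "F0 holomorphic_on {z. 0 < Im z}" "\<And>z. 0 < Im z \<Longrightarrow> 0 < Im (F0 z)"
    using F unfolding F0_def reflectionless_herglotz_def herglotz_def upper_half_plane_def by auto
  have F1: "F1 holomorphic_on {z. 0 < Im z}"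
    unfolding F1_def using sM fmM by (rule cauchy_transform_holomorphic)
  have F1_0: "0 \<le> Im (F1 z)" if "0 < Im z" for z
    unfolding F1_def using sM fmM that by (rule Im_cauchy_transform_nonneg)
  have split: "ennreal (Im (F0 z)) = ennreal (Im (F1 z)) +
      (ennreal (b * Im z) + (\<integral>\<^sup>+t. ennreal (Im z / ((t - Re z)\<^sup>2 + (Im z)\<^sup>2)) \<partial>R))" if "0 < Im z" for z
  proof -
    have "(\<integral>\<^sup>+t. f t \<partial>\<mu>) = (\<integral>\<^sup>+t. f t \<partial>M) + (\<integral>\<^sup>+t. f t \<partial>R)" if "f \<in> borel_measurable borel" for f
      unfolding M_def R_def using Kb s that
      by (intro nn_integral_split_restrict) (simp_all cong: measurable_cong_sets)
    then show ?thesis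
      unfolding F0_def F1_def Im_herglotz_rep[OF \<mu> that b] Im_cauchy_transform[OF sM fmM that]
      by (simp add: ac_simps)
  qed
  have F1_le: "Im (F1 z) \<le> Im (F0 z)" if "0 < Im z" for z
  proof -
    have "ennreal (Im (F1 z)) \<le> ennreal (Im (F0 z))" unfolding split[OF that] by simp
    then show ?thesis using F0(2)[OF that] by (simp add: ennreal_le_iff)
  qed
  have bd: "AE t in lborel. t \<in> E \<longrightarrow>
      ((\<lambda>y. Re (F0 (Complex t y))) \<longlongrightarrow> 0) (at_right 0) \<and> ((\<lambda>y. Im (F1 (Complex t y))) \<longlongrightarrow> 0) (at_right 0)"
  proof -
    have "AE t in lborel. t \<in> E \<longrightarrow> (\<exists>l. ((\<lambda>y. F0 (Complex t y)) \<longlongrightarrow> l) (at_right 0) \<and> Re l = 0)"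
      using F by (simp add: F0_def reflectionless_herglotz_def reflectionless_on_def)
    with notK show ?thesis
    proof eventually_elim
      case (elim t)
      have "((\<lambda>y. Im (F1 (Complex t y))) \<longlongrightarrow> 0) (at_right 0)"
        unfolding F1_def using sM fmM compact_imp_closed[OF K(1)] inK elim(1)
        by (rule Im_cauchy_transform_vanishes_off_support)
      moreover have "((\<lambda>y. Re (F0 (Complex t y))) \<longlongrightarrow> 0) (at_right 0)" if "t \<in> E"
        using elim(2) that by (metis tendsto_Re)
      ultimately show ?case by blast
    qed
  qed
  have lborel_fin: "emeasure lborel {a..b} < \<infinity>" for a b :: real
    by (simp add: emeasure_lborel_Icc_eq)
  have "AE x in M. x \<in> K \<and>
    ((\<lambda>h. measure lborel (E \<inter> {x - h<..<x + h}) / (2 * h)) \<longlongrightarrow> 0) (at_right 0)"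
    using inK AE_relative_density_zero[OF sM sR finM herglotz_measure_Icc_finite[OF R] K(1) RK]
      AE_relative_density_zero[OF sM sets_lborel finM lborel_fin K(1) LK]
  proof eventually_elim
    case (elim x)
    have "\<forall>\<^sub>F y in at_right 0. Im (F0 (Complex x y)) - Im (F1 (Complex x y)) \<le> c * Im (F0 (Complex x y))"
      if c: "0 < c" for c
    proof -
      have "\<forall>\<^sub>F y in at_right 0. ennreal b + (\<integral>\<^sup>+t. ennreal (1 / ((t - x)\<^sup>2 + y\<^sup>2)) \<partial>R)
          \<le> ennreal c * (\<integral>\<^sup>+t. ennreal (1 / ((t - x)\<^sup>2 + y\<^sup>2)) \<partial>M)"
        using R elim
        by (intro poisson_integral_negligible[OF sR sM herglotz_measure_sigma_finite[OF R] fmM _ _ _ b c])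
          (auto simp: herglotz_measure_def)
      moreover have "\<forall>\<^sub>F y in at_right 0. (0::real) < y" by (rule eventually_at_right_less)
      ultimately show ?thesis
      proof eventually_elim
        fix y :: real
        assume le: "ennreal b + (\<integral>\<^sup>+t. ennreal (1 / ((t - x)\<^sup>2 + y\<^sup>2)) \<partial>R)
          \<le> ennreal c * (\<integral>\<^sup>+t. ennreal (1 / ((t - x)\<^sup>2 + y\<^sup>2)) \<partial>M)" and y: "0 < y"
        let ?z = "Complex x y"
        have z: "0 < Im ?z" using y by simp
        have scale: "(\<integral>\<^sup>+t. ennreal (y / ((t - x)\<^sup>2 + y\<^sup>2)) \<partial>N)
            = ennreal y * (\<integral>\<^sup>+t. ennreal (1 / ((t - x)\<^sup>2 + y\<^sup>2)) \<partial>N)" if "sets N = sets borel" for N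
        proof -
          note that[measurable_cong]
          show ?thesis using y
            by (subst nn_integral_cmult[symmetric]) (auto simp: ennreal_mult[symmetric] add_nonneg_nonneg)
        qed
        have "ennreal (b * y) + (\<integral>\<^sup>+t. ennreal (y / ((t - x)\<^sup>2 + y\<^sup>2)) \<partial>R)
            = ennreal y * (ennreal b + (\<integral>\<^sup>+t. ennreal (1 / ((t - x)\<^sup>2 + y\<^sup>2)) \<partial>R))"
          using b y by (simp add: scale[OF sR] distrib_left ennreal_mult mult.commute)
        also have "\<dots> \<le> ennreal y * (ennreal c * (\<integral>\<^sup>+t. ennreal (1 / ((t - x)\<^sup>2 + y\<^sup>2)) \<partial>M))"
          using le by (rule mult_left_mono) simp
        also have "\<dots> = ennreal c * ennreal (Im (F1 ?z))"
          using Im_cauchy_transform[OF sM fmM z] by (simp add: F1_def scale[OF sM] mult_ac)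
        finally have "ennreal (Im (F0 ?z)) \<le> ennreal (Im (F1 ?z)) + ennreal c * ennreal (Im (F1 ?z))"
          using split[OF z] by (simp add: add_left_mono)
        also have "\<dots> = ennreal (Im (F1 ?z) + c * Im (F1 ?z))"
          using c F1_0[OF z] by (simp add: ennreal_mult)
        finally have "Im (F0 ?z) \<le> Im (F1 ?z) + c * Im (F1 ?z)"
          using c F1_0[OF z] by (subst (asm) ennreal_le_iff) auto
        moreover have "c * Im (F1 ?z) \<le> c * Im (F0 ?z)"
          using c F1_le[OF z] by (intro mult_left_mono) auto
        ultimately show "Im (F0 ?z) - Im (F1 ?z) \<le> c * Im (F0 ?z)" by linarith
      qed
    qed
    then show ?case
      using density_zero_of_dominated_part[OF F0 F1 F1_le E bd] elim(1) by blast
  qed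
  then show ?thesis unfolding M_def .
qed

section \<open>Weakly homogeneous sets\<close>

theorem corollary2p3:
  fixes E :: "real set" and \<mu> :: "real measure"
  assumes "weakly_homogeneous E"
    and "\<mu> \<in> reflectionless_measures E"
  shows "emeasure (singular_part \<mu>) E = 0"
proof (rule ccontr)
  assume nonzero: "emeasure (singular_part \<mu>) E \<noteq> 0"
  have E: "E \<in> sets borel" and pos: "\<And>x. x \<in> E \<Longrightarrow> Limsup (at_right 0)
        (\<lambda>h. ereal (measure lborel (E \<inter> {x - h<..<x + h}) / (2 * h))) > 0"
    using assms(1) by (auto simp: weakly_homogeneous_def)
  obtain a b where \<mu>: "herglotz_measure \<mu>" and b: "0 \<le> b"
    and F: "herglotz_rep a b \<mu> \<in> reflectionless_herglotz E"
    using assms(2) by (auto simp: reflectionless_measures_def)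
  have s: "sets \<mu> = sets borel" using \<mu> by (simp add: herglotz_measure_def)
  obtain \<alpha> where d: "lebesgue_decomposition \<mu> \<alpha> (singular_part \<mu>)"
    using herglotz_measure_singular_part[OF \<mu>] by blast
  then obtain N where N: "N \<in> null_sets lborel" "emeasure (singular_part \<mu>) (- N) = 0"
    by (auto simp: lebesgue_decomposition_def)
  have "emeasure \<mu> (E \<inter> N) \<noteq> 0"
    using lebesgue_decomposition_singular_on[OF d N N(1) order_refl E] nonzero by simp
  moreover have "E \<inter> N \<in> sets borel" using E N(1) by auto
  ultimately obtain K where K: "compact K" "K \<subseteq> E \<inter> N" "emeasure \<mu> K \<noteq> 0"
    using compact_subset_positive_measure[OF \<mu>] by metis
  have Kb: "K \<in> sets borel" using K(1) by (rule borel_compact)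
  have null: "K \<in> null_sets lborel" by (rule null_sets_subset[OF N(1)]) (use K(2) Kb in auto)
  let ?M = "density \<mu> (indicator K)"
  have "emeasure ?M (space ?M) = emeasure \<mu> K"
    using Kb s sets_eq_imp_space_eq[OF s] by (simp add: emeasure_restricted)
  then have "ae_filter ?M \<noteq> bot" using K(3) by (simp add: ae_filter_eq_bot_iff)
  then obtain x where x: "x \<in> K"
    "((\<lambda>h. measure lborel (E \<inter> {x - h<..<x + h}) / (2 * h)) \<longlongrightarrow> 0) (at_right 0)"
    using eventually_happens'[OF _ reflectionless_density_zero[OF \<mu> b F E K(1) null]] by blast
  have "Limsup (at_right 0) (\<lambda>h. ereal (measure lborel (E \<inter> {x - h<..<x + h}) / (2 * h))) = ereal 0"
    using x(2) by (intro lim_imp_Limsup) auto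
  then show False using pos[of x] x(1) K(2) by auto
qed

end
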